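(* For generic $\gamma$, \begin{multline*}Z_n(x;y;\lambda)=\frac{(-1)^{\binom n2}[\lambda+n]}{[1]^{n^2}[\gamma]^n\big[|x|-|y|+\lambda+\gamma+n\big]} \frac{\prod_{i,j=1}^n[x_i-y_j][x_i+1-y_j]}{\prod_{1\leq i<j\leq n}[x_i-x_j][y_i-y_j]}\\ \times\sum_{S\subseteq\{1,\dots,n\}}(-1)^{|S|} \frac{[\lambda+\gamma+n-|S|]}{[\lambda+n-|S|]}\det_{1\leq i,j\leq n}\left(\frac{[x_i^S-y_j+\gamma]}{[x_i^S-y_j]}\right),\end{multline*} where $x_i^S=x_i+1$ if $i\in S$ and $x_i^S=x_i$ if $i\notin S$.
   Context: Fix $\tau,\eta$ with $\operatorname{Im}(\tau)>0$, $\eta\notin\mathbb Z+\tau\mathbb Z$; let $p=e^{2\pi i\tau}$, $q=e^{2\pi i\eta}$, $q^x=e^{2\pi i\eta x}$, and $[x]=q^{-x/2}\prod_{j\ge0}(1-p^jq^x)(1-p^{j+1}q^{-x})$. A state is an $(n+1)\times(n+1)$ integer matrix with adjacent entries differing by $1$, first row and first column $0,1,\dots,n$, last row and last column $n,n-1,\dots,0$. Each block $\left(\begin{smallmatrix}a&b\\c&d\end{smallmatrix}\right)$ (adjacent $2\times2$ submatrix) at position $(i,j)$, $1\le i,j\le n$, has weight $R^{b-a,d-b}_{d-c,c-a}(\lambda+a,x_i-y_j)$, with $R^{++}_{++}=R^{--}_{--}=[u+1]/[1]$, $R^{+-}_{+-}(\lambda,u)=[u][\lambda+1]/([1][\lambda])$,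 $R^{-+}_{-+}(\lambda,u)=[u][\lambda-1]/([1][\lambda])$, $R^{-+}_{+-}(\lambda,u)=[\lambda+u]/[\lambda]$, $R^{+-}_{-+}(\lambda,u)=[\lambda-u]/[\lambda]$. $Z_n(x;y;\lambda)$ is the sum over states of products of block weights (8VSOS model, domain wall boundary conditions), for generic complex $\lambda,x_i,y_j$. $|x|=x_1+\dots+x_n$, $|y|=y_1+\dots+y_n$, $|S|$ is the cardinality of $S$. *)

theory Defs
  imports "HOL-Analysis.Infinite_Products" "Jordan_Normal_Form.Determinant"
begin

text \<open>The theta function \<open>[x]\<close>, with \<open>p = exp(2 \<pi> i \<tau>)\<close> and \<open>q\<^sup>x = exp(2 \<pi> i \<eta> x)\<close>. The factor
  \<open>q\<^sup>-\<^sup>x\<^sup>/\<^sup>2\<close> is \<open>exp(- \<pi> i \<eta> x)\<close>, so no choice of branch is involved.\<close>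

definition br :: "complex \<Rightarrow> complex \<Rightarrow> complex \<Rightarrow> complex" where
  "br \<tau> \<eta> x =
     (let p = exp (2 * of_real pi * \<i> * \<tau>);
          qpow = (\<lambda>z. exp (2 * of_real pi * \<i> * \<eta> * z))
      in qpow (- x / 2) * (\<Prod>j. (1 - p ^ j * qpow x) * (1 - p ^ (j + 1) * qpow (- x))))"

text \<open>\<open>Rmat \<tau> \<eta> a b c d \<lambda> u\<close> is \<open>R\<^sup>a\<^sup>b\<^sub>c\<^sub>d(\<lambda>, u)\<close>: upper indices first, then lower ones, and the signs
  \<open>+\<close>, \<open>-\<close> are the integers \<open>1\<close>, \<open>-1\<close>. Of the sixteen sign patterns only those with
  \<open>a + b = c + d\<close> come from a block; these are the six listed, so the final \<open>0\<close> is never used.\<close>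

definition Rmat ::
  "complex \<Rightarrow> complex \<Rightarrow> int \<Rightarrow> int \<Rightarrow> int \<Rightarrow> int \<Rightarrow> complex \<Rightarrow> complex \<Rightarrow> complex" where
  "Rmat \<tau> \<eta> a b c d lam u =
     (if (a, b, c, d) = (1, 1, 1, 1) \<or> (a, b, c, d) = (-1, -1, -1, -1)
        then br \<tau> \<eta> (u + 1) / br \<tau> \<eta> 1
      else if (a, b, c, d) = (1, -1, 1, -1)
        then br \<tau> \<eta> u * br \<tau> \<eta> (lam + 1) / (br \<tau> \<eta> 1 * br \<tau> \<eta> lam)
      else if (a, b, c, d) = (-1, 1, -1, 1)
        then br \<tau> \<eta> u * br \<tau> \<eta> (lam - 1) / (br \<tau> \<eta> 1 * br \<tau> \<eta> lam)
      else if (a, b, c, d) = (-1, 1, 1, -1)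
        then br \<tau> \<eta> (lam + u) / br \<tau> \<eta> lam
      else if (a, b, c, d) = (1, -1, -1, 1)
        then br \<tau> \<eta> (lam - u) / br \<tau> \<eta> lam
      else 0)"

definition states :: "nat \<Rightarrow> int mat set" where
  "states n = {A \<in> carrier_mat (n + 1) (n + 1).
     (\<forall>i\<le>n. \<forall>j<n. \<bar>A $$ (i, j + 1) - A $$ (i, j)\<bar> = 1) \<and>
     (\<forall>i<n. \<forall>j\<le>n. \<bar>A $$ (i + 1, j) - A $$ (i, j)\<bar> = 1) \<and>
     (\<forall>k\<le>n. A $$ (0, k) = int k \<and> A $$ (k, 0) = int k \<and>
            A $$ (n, k) = int (n - k) \<and> A $$ (k, n) = int (n - k))}"

text \<open>Matrix entries are indexed from \<open>0\<close>, blocks from \<open>1\<close>: the block at position \<open>(i, j)\<close> has its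
  lower right entry at \<open>(i, j)\<close>.\<close>

definition block_weight ::
  "complex \<Rightarrow> complex \<Rightarrow> (nat \<Rightarrow> complex) \<Rightarrow> (nat \<Rightarrow> complex) \<Rightarrow> complex \<Rightarrow> int mat \<Rightarrow> nat \<Rightarrow> nat \<Rightarrow> complex"
  where
  "block_weight \<tau> \<eta> x y lam A i j =
     (let a = A $$ (i - 1, j - 1); b = A $$ (i - 1, j);
          c = A $$ (i, j - 1); d = A $$ (i, j)
      in Rmat \<tau> \<eta> (b - a) (d - b) (d - c) (c - a) (lam + of_int a) (x i - y j))"

definition Z ::
  "complex \<Rightarrow> complex \<Rightarrow> nat \<Rightarrow> (nat \<Rightarrow> complex) \<Rightarrow> (nat \<Rightarrow> complex) \<Rightarrow> complex \<Rightarrow> complex" where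
  "Z \<tau> \<eta> n x y lam = (\<Sum>A\<in>states n. \<Prod>i=1..n. \<Prod>j=1..n. block_weight \<tau> \<eta> x y lam A i j)"

definition xshift :: "(nat \<Rightarrow> complex) \<Rightarrow> nat set \<Rightarrow> nat \<Rightarrow> complex" where
  "xshift x S i = (if i \<in> S then x i + 1 else x i)"

text \<open>The sum defining \<^const>\<open>Z\<close> is over a finite set.\<close>

lemma finite_states: "finite (states n)"
proof -
  let ?I = "{..n} \<times> {..n}"
  let ?V = "{- int (2 * n)..int (2 * n)}"
  have bound: "\<bar>A $$ (i, j)\<bar> \<le> int (i + j)" if A: "A \<in> states n" and j: "j \<le> n" and i: "i \<le> n" for A i j
    using i
  proof (induction i)
    case 0
    then show ?case using A j by (auto simp: states_def)
  next
    case (Suc i)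
    have "\<bar>A $$ (i + 1, j) - A $$ (i, j)\<bar> = 1"
      using A j Suc.prems by (auto simp: states_def)
    then show ?case using Suc by auto
  qed
  have "states n \<subseteq> (\<lambda>f. mat (n + 1) (n + 1) f) ` (?I \<rightarrow>\<^sub>E ?V)"
  proof
    fix A assume A: "A \<in> states n"
    have "A = mat (n + 1) (n + 1) (restrict (\<lambda>ij. A $$ ij) ?I)"
      using A by (intro eq_matI) (auto simp: states_def)
    moreover have "restrict (\<lambda>ij. A $$ ij) ?I \<in> ?I \<rightarrow>\<^sub>E ?V"
    proof (rule restrict_PiE_iff[THEN iffD2], rule ballI)
      fix ij assume "ij \<in> ?I"
      then obtain i j where ij: "ij = (i, j)" "i \<le> n" "j \<le> n" by auto
      have "\<bar>A $$ (i, j)\<bar> \<le> int (i + j)" using bound[OF A] ij by simp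
      then have "- int (2 * n) \<le> A $$ (i, j)" "A $$ (i, j) \<le> int (2 * n)"
        using ij by linarith+
      then show "A $$ ij \<in> ?V" using ij by simp
    qed
    ultimately show "A \<in> (\<lambda>f. mat (n + 1) (n + 1) f) ` (?I \<rightarrow>\<^sub>E ?V)" by (rule image_eqI)
  qed
  moreover have "finite (?I \<rightarrow>\<^sub>E ?V)" by (rule finite_PiE) simp_all
  ultimately show ?thesis using finite_subset finite_imageI by metis
qed

end

theory Submission
  imports Defs "HOL-Complex_Analysis.Complex_Analysis"
begin

text \<open>
  Both sides, cleared of denominators, are theta functions of order \<open>2n\<close> in \<open>x\<^sub>n\<close> with the same
  multipliers. Such a function vanishes as soon as it has \<open>2n\<close> zeros whose sum is generic, and
  the points \<open>x\<^sub>n = y\<^sub>j\<close> and \<open>x\<^sub>n = y\<^sub>j - 1\<close> qualify because \<open>[\<gamma>] \<noteq> 0\<close>. At these points the partition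
  function freezes to one of size \<open>n - 1\<close> (with \<open>\<lambda> + 1\<close> and \<open>\<lambda>\<close> respectively): for the extreme columns
  this is visible on the corner block, and the Yang-Baxter equation makes \<open>Z\<^sub>n\<close> symmetric in \<open>y\<close>. On the
  determinant side only one entry of the last row survives, so induction on \<open>n\<close> applies. This proves
  the identity for generic \<open>\<lambda>\<close> and \<open>y\<close>, and the remaining parameters follow by continuity.
\<close>

section \<open>The theta function\<close>


text \<open>The parameter \<gamma> is what makes interpolation possible. The 2n nodes y_j and y_j -
  1 have a sum differing from the zero sum prescribed by the multipliers exactly by \<gamma>; for
  \<gamma> = 0 the product of all [x_n - y_j][x_n + 1 - y_j] would be a nonzero function with the
  same multipliers and the same zeros.

  The two families of nodes separate the two halves of the sum over S. Once row denominators are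
  cleared, only subsets without n survive at x_n = y_j, and only subsets with n at x_n = y_j - 1. In
  the first case \<lambda> + n - |S| equals (\<lambda> + 1) + (n - 1) - |S|, in the second \<lambda>
  + (n - 1) - |S - {n}|.

  The induction shifts \<lambda> by integers, cancels factors [y_a - y_b + 1] when swapping columns,
  and needs incongruent nodes. Along a suitable line in the parameters \<lambda> and y each of these
  conditions excludes countably many points, so all of them can be avoided at once.\<close>

definition qpoch :: "complex \<Rightarrow> complex \<Rightarrow> complex" where
  "qpoch p z = (\<Prod>j. 1 - p ^ j * z)"

lemma convergent_prod_qpoch:
  assumes "norm p < 1"
  shows "convergent_prod (\<lambda>j. 1 - p ^ j * (z :: complex))"
proof -
  have "summable (\<lambda>j. norm z * norm p ^ j)"
    using assms by (intro summable_mult summable_geometric) simp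
  then have "summable (\<lambda>j. norm ((1 - p ^ j * z) - 1))"
    by (simp add: norm_mult norm_power mult.commute)
  then show ?thesis
    by (intro abs_convergent_prod_imp_convergent_prod summable_imp_abs_convergent_prod)
qed

text \<open>The source of the functional equations of [x]: replacing z by p z drops the first
  factor.\<close>

lemma qpoch_rec:
  assumes "norm p < 1"
  shows "qpoch p z = (1 - z) * qpoch p (p * z)"
proof -
  have "(\<lambda>j. 1 - p ^ j * z) has_prod ((\<Prod>k<1. 1 - p ^ k * z) * (\<Prod>k. 1 - p ^ (k + 1) * z))"
    by (rule has_prod_ignore_initial_segment'[OF convergent_prod_qpoch[OF assms]])
  then show ?thesis
    unfolding qpoch_def by (simp add: has_prod_unique mult_ac flip: has_prod_unique)
qed

lemma qpoch_eq_0_iff: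
  assumes "norm p < 1"
  shows "qpoch p z = 0 \<longleftrightarrow> (\<exists>j. p ^ j * z = 1)"
proof -
  have "(\<lambda>j. 1 - p ^ j * z) has_prod qpoch p z"
    unfolding qpoch_def by (rule convergent_prod_has_prod[OF convergent_prod_qpoch[OF assms]])
  from has_prod_eq_0_iff[OF this] show ?thesis by force
qed

text \<open>On a ball of radius 1 the deviations of the factors from 1 are bounded by a geometric
  series, so the entire partial products converge locally uniformly.\<close>

lemma holomorphic_qpoch:
  assumes p: "norm p < 1"
  shows "qpoch p holomorphic_on UNIV"
proof (rule holomorphic_uniform_sequence[where f = "\<lambda>n z. \<Prod>j<n. 1 - p ^ j * z"])
  show "(\<lambda>z. \<Prod>j<n. 1 - p ^ j * z) holomorphic_on UNIV" for n
    by (intro holomorphic_intros)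
  fix x :: complex
  define R where "R = norm x + 1"
  have "uniformly_convergent_on (cball x 1) (\<lambda>N z. \<Prod>j<N. 1 - p ^ j * z)"
  proof (rule uniformly_convergent_on_prod')
    show "uniformly_convergent_on (cball x 1) (\<lambda>N z. \<Sum>j<N. norm ((1 - p ^ j * z) - 1))"
    proof (rule Weierstrass_m_test'_ev)
      show "summable (\<lambda>j. R * norm p ^ j)"
        using p by (intro summable_mult summable_geometric) simp
      show "\<forall>\<^sub>F j in sequentially. \<forall>z\<in>cball x 1. norm (norm ((1 - p ^ j * z) - 1)) \<le> R * norm p ^ j"
      proof (intro always_eventually allI ballI)
        fix j z assume "z \<in> cball x 1"
        then have "norm (x - z) \<le> 1" by (simp add: dist_norm)
        then have "norm z \<le> R" unfolding R_def by norm
        then show "norm (norm ((1 - p ^ j * z) - 1)) \<le> R * norm p ^ j"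
          by (simp add: norm_mult norm_power mult.commute mult_right_mono)
      qed
    qed
  qed (auto intro!: continuous_intros)
  then have "uniform_limit (cball x 1) (\<lambda>N z. \<Prod>j<N. 1 - p ^ j * z)
      (\<lambda>z. lim (\<lambda>N. \<Prod>j<N. 1 - p ^ j * z)) sequentially"
    by (simp add: uniformly_convergent_uniform_limit_iff)
  moreover have "lim (\<lambda>N. \<Prod>j<N. 1 - p ^ j * z) = qpoch p z" for z
    unfolding qpoch_def
    by (intro limI has_prod_imp_tendsto' convergent_prod_has_prod convergent_prod_qpoch p)
  ultimately show "\<exists>d>0. cball x d \<subseteq> UNIV \<and>
      uniform_limit (cball x d) (\<lambda>n z. \<Prod>j<n. 1 - p ^ j * z) (qpoch p) sequentially"
    by (intro exI[of _ 1]) simp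
qed simp

text \<open>A countable set has no interior in the complex plane. Degenerate parameters lie in
  countable unions of lattices, so this principle removes infinitely many genericity conditions at a
  time.\<close>

lemma isCont_eq_off_countable:
  fixes f :: "complex \<Rightarrow> 'a :: t1_space"
  assumes "isCont f z" "countable C" "\<And>t. t \<notin> C \<Longrightarrow> f t = c"
  shows "f z = c"
proof (rule ccontr)
  assume "f z \<noteq> c"
  then have "\<forall>\<^sub>F t in nhds z. f t \<noteq> c"
    using eventually_compose_filterlim[OF t1_space_nhds] assms(1)
    unfolding isCont_def tendsto_at_iff_tendsto_nhds by blast
  then obtain e where "e > 0" "\<And>t. dist t z < e \<Longrightarrow> f t \<noteq> c"
    by (auto simp: eventually_nhds_metric)
  then have "ball z e \<subseteq> C" using assms(3) by (metis dist_commute mem_ball subsetI)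
  then show False using \<open>e > 0\<close> assms(2) countable_subset uncountable_ball by blast
qed

locale theta =
  fixes \<tau> \<eta> :: complex
  assumes Im_tau: "Im \<tau> > 0"
    and eta_lattice: "\<eta> \<notin> {of_int k + \<tau> * of_int l | k l. True}"
begin

abbreviation p where "p \<equiv> exp (2 * of_real pi * \<i> * \<tau>)"
abbreviation Q where "Q x \<equiv> exp (2 * of_real pi * \<i> * \<eta> * x)"
abbreviation B where "B \<equiv> br \<tau> \<eta>"

lemma eta_nz: "\<eta> \<noteq> 0"
  using eta_lattice by (metis (mono_tags, lifting) add.right_neutral mem_Collect_eq mult_zero_right of_int_0)

lemma norm_p: "norm p < 1"
  using Im_tau by simp

lemma br_qpoch: "B x = exp (- of_real pi * \<i> * \<eta> * x) * qpoch p (Q x) * qpoch p (p * Q (- x))"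
proof -
  have "(\<Prod>j. (1 - p ^ j * Q x) * (1 - p ^ j * (p * Q (- x)))) = qpoch p (Q x) * qpoch p (p * Q (- x))"
    unfolding qpoch_def
    by (intro prodinf_mult[symmetric] convergent_prod_qpoch norm_p)
  then show ?thesis
    unfolding br_def Let_def by (simp add: mult_ac)
qed

lemma holomorphic_B: "B holomorphic_on UNIV"
proof -
  have "(\<lambda>x. qpoch p (g x)) holomorphic_on UNIV" if "g holomorphic_on UNIV" for g
    using holomorphic_on_compose_gen[OF that holomorphic_qpoch[OF norm_p]] by (simp add: o_def)
  note this [holomorphic_intros]
  show ?thesis unfolding br_qpoch[abs_def]
    by (intro holomorphic_intros)
qed

lemma holomorphic_B' [holomorphic_intros]:
  "f holomorphic_on S \<Longrightarrow> (\<lambda>x. B (f x)) holomorphic_on S"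
  using holomorphic_on_compose_gen[OF _ holomorphic_B, of f S] by (simp add: o_def)

lemma isCont_B [continuous_intros]:
  "isCont f x \<Longrightarrow> isCont (\<lambda>x. B (f x)) x"
  using holomorphic_on_imp_continuous_on[OF holomorphic_B]
  by (simp add: continuous_on_eq_continuous_at isCont_o2)

text \<open>Splitting off the factor j = 0 of the first product leaves
  \<open>exp (- of_real pi * \<i> * \<eta> * x) * (1 - Q x)\<close>, which is odd, times a product
  that is symmetric in x and -x.\<close>

lemma B_minus: "B (- x) = - B x"
proof -
  have alg: "E * ((1 - q') * a) * b = - (F * ((1 - q) * b) * a)" if "E = F * q" "q * q' = 1"
    for E F q q' a b :: complex
  proof -
    have "E * ((1 - q') * a) * b = F * (q - q * q') * a * b"
      using that(1) by (simp add: algebra_simps)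
    then show ?thesis using that(2) by (simp add: algebra_simps)
  qed
  have E: "exp (of_real pi * \<i> * \<eta> * x) = exp (- of_real pi * \<i> * \<eta> * x) * Q x"
    by (simp add: mult_ac flip: exp_add)
  have "Q x * Q (- x) = 1" by (simp flip: exp_add)
  from alg[OF E this, of "qpoch p (p * Q (- x))" "qpoch p (p * Q x)"]
  show ?thesis
    unfolding br_qpoch
    using qpoch_rec[OF norm_p, of "Q x"] qpoch_rec[OF norm_p, of "Q (- x)"] by simp
qed

lemma B_period1: "B (x + 1 / \<eta>) = - B x"
proof -
  have "Q (x + 1 / \<eta>) = Q x" "Q (- (x + 1 / \<eta>)) = Q (- x)"
    using eta_nz by (simp_all add: ring_distribs exp_add exp_diff flip: exp_of_real)
  moreover have "exp (- of_real pi * \<i> * \<eta> * (x + 1 / \<eta>)) = - exp (- of_real pi * \<i> * \<eta> * x)"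
    using eta_nz by (simp add: ring_distribs exp_add exp_diff)
  ultimately show ?thesis unfolding br_qpoch by simp
qed

text \<open>The shift multiplies \<open>Q x\<close> by \<open>p\<close>: the first product loses the
  factor 1 - Q x and the second gains 1 - Q (- x). Their quotient is - Q (- x).\<close>

lemma B_period2: "B (x + \<tau> / \<eta>) = - exp (- 2 * of_real pi * \<i> * \<eta> * x - of_real pi * \<i> * \<tau>) * B x"
proof -
  have Q: "Q (x + \<tau> / \<eta>) = p * Q x" "p * Q (- (x + \<tau> / \<eta>)) = Q (- x)"
    using eta_nz by (simp_all add: ring_distribs add_ac mult.assoc flip: exp_add)
  have E: "exp (- of_real pi * \<i> * \<eta> * (x + \<tau> / \<eta>)) = exp (- of_real pi * \<i> * \<eta> * x) * exp (- of_real pi * \<i> * \<tau>)"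
    unfolding exp_add[symmetric] by (rule arg_cong[where f = exp]) (use eta_nz in \<open>simp add: ring_distribs\<close>)
  have F: "exp (- 2 * of_real pi * \<i> * \<eta> * x - of_real pi * \<i> * \<tau>) = Q (- x) * exp (- of_real pi * \<i> * \<tau>)"
    by (simp flip: exp_add)
  have "Q (- x) * Q x = 1" by (simp flip: exp_add)
  then have "(1 - Q (- x)) = - Q (- x) * (1 - Q x)" by (simp add: algebra_simps)
  then show ?thesis
    unfolding br_qpoch Q E F
    using qpoch_rec[OF norm_p, of "Q x"] qpoch_rec[OF norm_p, of "Q (-x)"]
    by (simp add: mult_ac)
qed

text \<open>The two infinite products vanish on complementary parts of the lattice, the first where
  l \<le> 0 and the second where l \<ge> 1.\<close>

lemma B_eq_0_iff: "B x = 0 \<longleftrightarrow> (\<exists>k l. \<eta> * x = of_int k + \<tau> * of_int l)"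
proof -
  have *: "exp (2 * of_real pi * \<i> * w) = 1 \<longleftrightarrow> (\<exists>k. w = of_int k)" for w :: complex
  proof -
    have "exp (2 * of_real pi * \<i> * w) = 1 \<longleftrightarrow> (\<exists>k. 2 * of_real pi * \<i> * w = 2 * of_real pi * \<i> * of_int k)"
      using exp_eq[of "2 * of_real pi * \<i> * w" 0] by (simp add: mult_ac)
    then show ?thesis by simp
  qed
  have pj: "p ^ j = exp (2 * of_real pi * \<i> * (of_nat j * \<tau>))" for j
    by (simp add: mult_ac flip: exp_of_nat_mult)
  have 1: "p ^ j * Q x = exp (2 * of_real pi * \<i> * (\<eta> * x + of_nat j * \<tau>))" for j
    unfolding pj by (simp add: algebra_simps flip: exp_add)
  have 2: "p ^ j * (p * Q (- x)) = exp (2 * of_real pi * \<i> * (of_nat (Suc j) * \<tau> - \<eta> * x))" for j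
    unfolding pj by (simp add: algebra_simps flip: exp_add)
  have "B x = 0 \<longleftrightarrow> (\<exists>j k. \<eta> * x + of_nat j * \<tau> = of_int k) \<or> (\<exists>j k. of_nat (Suc j) * \<tau> - \<eta> * x = of_int k)"
    unfolding br_qpoch mult_eq_0_iff qpoch_eq_0_iff[OF norm_p] 1 2 * by auto
  also have "\<dots> \<longleftrightarrow> (\<exists>k l. \<eta> * x = of_int k + \<tau> * of_int l)"
  proof
    assume "(\<exists>j k. \<eta> * x + of_nat j * \<tau> = of_int k) \<or> (\<exists>j k. of_nat (Suc j) * \<tau> - \<eta> * x = of_int k)"
    then show "\<exists>k l. \<eta> * x = of_int k + \<tau> * of_int l"
    proof (elim disjE exE)
      fix j k assume "\<eta> * x + of_nat j * \<tau> = of_int k"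
      then show ?thesis by (intro exI[of _ k] exI[of _ "- int j"]) (simp add: algebra_simps eq_diff_eq)
    next
      fix j k assume "of_nat (Suc j) * \<tau> - \<eta> * x = of_int k"
      then show ?thesis by (intro exI[of _ "- k"] exI[of _ "int (Suc j)"]) (simp add: algebra_simps)
    qed
  next
    assume "\<exists>k l. \<eta> * x = of_int k + \<tau> * of_int l"
    then obtain k l where kl: "\<eta> * x = of_int k + \<tau> * of_int l" by blast
    show "(\<exists>j k. \<eta> * x + of_nat j * \<tau> = of_int k) \<or> (\<exists>j k. of_nat (Suc j) * \<tau> - \<eta> * x = of_int k)"
    proof (cases "l \<le> 0")
      case True
      then have "\<eta> * x + of_nat (nat (- l)) * \<tau> = of_int k" using kl by simp
      then show ?thesis by blast
    next
      case False
      then have "of_nat (Suc (nat (l - 1))) = (of_int l :: complex)" by simp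
      then have "of_nat (Suc (nat (l - 1))) * \<tau> - \<eta> * x = of_int (- k)"
        using kl by (simp only: of_int_minus) simp
      then show ?thesis by blast
    qed
  qed
  finally show ?thesis .
qed

lemma B_0 [simp]: "B 0 = 0"
  unfolding B_eq_0_iff by (intro exI[of _ 0]) simp

lemma B_1: "B 1 \<noteq> 0"
  using eta_lattice unfolding B_eq_0_iff by auto

text \<open>The integer slope \<open>m\<close> serves the later deformation of \<open>Y j\<close> to
  \<open>Y j + of_nat j * t\<close>, whose differences move with integer speed.\<close>

lemma countable_B_zeros: "countable {t. B (a + of_int m * t) = 0}" if "m \<noteq> 0"
proof -
  have "{t. B (a + of_int m * t) = 0} \<subseteq> (\<lambda>(k, l). ((of_int k + \<tau> * of_int l) / \<eta> - a) / of_int m) ` (UNIV :: (int \<times> int) set)"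
    using that eta_nz by (fastforce simp: B_eq_0_iff image_iff field_simps)
  then show ?thesis by (rule countable_subset) simp
qed

section \<open>Quasi-periods and simplicity of the zeros\<close>

text \<open>Leaving the multiplier unspecified makes these periods visibly a group, so that every
  lattice point is reached from the two generators without computing its multiplier.\<close>

definition mult_period :: "complex \<Rightarrow> bool" where
  "mult_period a \<longleftrightarrow> (\<exists>c d. c \<noteq> 0 \<and> (\<forall>x. B (a + x) = c * exp (d * x) * B x))"

lemma mult_period_add:
  assumes "mult_period a" "mult_period b"
  shows "mult_period (a + b)"
proof -
  obtain c d c' d' where *: "c \<noteq> 0" "\<And>x. B (a + x) = c * exp (d * x) * B x"
      "c' \<noteq> 0" "\<And>x. B (b + x) = c' * exp (d' * x) * B x"
    using assms unfolding mult_period_def by blast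
  have "B (a + b + x) = (c * c' * exp (d * b)) * exp ((d + d') * x) * B x" for x
    using *(2)[of "b + x"] *(4)[of x] by (simp add: algebra_simps exp_add)
  then show ?thesis using *(1,3) unfolding mult_period_def
    by (intro exI[of _ "c * c' * exp (d * b)"] exI[of _ "d + d'"]) simp
qed

lemma mult_period_minus:
  assumes "mult_period a"
  shows "mult_period (- a)"
proof -
  obtain c d where *: "c \<noteq> 0" "\<And>x. B (a + x) = c * exp (d * x) * B x"
    using assms unfolding mult_period_def by blast
  have "B (- a + x) = (exp (d * a) / c) * exp (- d * x) * B x" for x
    using *(2)[of "- a + x"] *(1) by (simp add: field_simps exp_add exp_diff exp_minus)
  then show ?thesis using *(1) unfolding mult_period_def
    by (intro exI[of _ "exp (d * a) / c"] exI[of _ "- d"]) simp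
qed

lemma mult_period_int:
  assumes "mult_period a"
  shows "mult_period (of_int k * a)"
proof (induction k rule: int_induct[where k = 0])
  case base
  show ?case unfolding mult_period_def by (intro exI[of _ 1] exI[of _ 0]) simp
next
  case (step1 k)
  then show ?case using mult_period_add[OF _ assms] by (simp add: ring_distribs)
next
  case (step2 k)
  then show ?case using mult_period_add[OF _ mult_period_minus[OF assms]] by (simp add: ring_distribs)
qed

lemma B_zero_mult_period:
  assumes "B a = 0"
  shows "mult_period a"
proof -
  have "mult_period (1 / \<eta>)"
    unfolding mult_period_def
    by (intro exI[of _ "-1"] exI[of _ 0]) (use B_period1 in \<open>simp add: add.commute\<close>)
  moreover have "mult_period (\<tau> / \<eta>)"
    unfolding mult_period_def
    by (intro exI[of _ "- exp (- of_real pi * \<i> * \<tau>)"] exI[of _ "- 2 * of_real pi * \<i> * \<eta>"])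
      (use B_period2 in \<open>simp add: add.commute exp_diff exp_minus field_simps\<close>)
  moreover obtain k l where "\<eta> * a = of_int k + \<tau> * of_int l" using assms B_eq_0_iff by blast
  then have "a = of_int k * (1 / \<eta>) + of_int l * (\<tau> / \<eta>)" using eta_nz by (simp add: field_simps)
  ultimately show ?thesis by (metis mult_period_add mult_period_int)
qed

text \<open>At 0 the derivative is read off from \<open>B x = (1 - Q x) * H x\<close> with
  \<open>H 0 = qpoch p p ^ 2\<close>; a quasi-period carries it to every other zero, multiplied by a
  nonzero constant.\<close>

lemma B_has_derivative_at_zero:
  assumes "B a = 0"
  shows "\<exists>D. D \<noteq> 0 \<and> (B has_field_derivative D) (at a)"
proof -
  define H where "H x = exp (- of_real pi * \<i> * \<eta> * x) * qpoch p (p * Q x) * qpoch p (p * Q (- x))" for x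
  have H: "B x = (1 - Q x) * H x" for x
    unfolding H_def br_qpoch using qpoch_rec[OF norm_p, of "Q x"] by simp
  have "H 0 = qpoch p p ^ 2" by (simp add: H_def power2_eq_square)
  moreover have "qpoch p p \<noteq> 0"
  proof
    assume "qpoch p p = 0"
    then obtain j where "p ^ j * p = 1" using qpoch_eq_0_iff[OF norm_p] by blast
    then have "norm p ^ Suc j = 1" by (metis norm_one norm_power power_Suc2)
    moreover have "norm p ^ Suc j < 1" using norm_p by (intro power_Suc_less_one) auto
    ultimately show False by simp
  qed
  ultimately have H0: "H 0 \<noteq> 0" by simp
  have qh: "(\<lambda>x. qpoch p (g x)) holomorphic_on UNIV" if "g holomorphic_on UNIV" for g
    using holomorphic_on_compose_gen[OF that holomorphic_qpoch[OF norm_p]] by (simp add: o_def)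
  have "H holomorphic_on UNIV" unfolding H_def[abs_def]
    by (intro holomorphic_intros qh)
  then obtain H' where H': "(H has_field_derivative H') (at 0)"
    by (meson UNIV_I field_differentiable_def holomorphic_on_imp_differentiable_at open_UNIV)
  have "((\<lambda>x. (1 - Q x) * H x) has_field_derivative (- 2 * of_real pi * \<i> * \<eta> * H 0)) (at 0)"
    by (auto intro!: derivative_eq_intros H')
  then have D0: "(B has_field_derivative (- 2 * of_real pi * \<i> * \<eta> * H 0)) (at 0)"
    by (simp add: H[abs_def])
  obtain c d where c: "c \<noteq> 0" "\<And>x. B (a + x) = c * exp (d * x) * B x"
    using B_zero_mult_period[OF assms] unfolding mult_period_def by blast
  have "((\<lambda>x. c * exp (d * x) * B x) has_field_derivative c * (- 2 * of_real pi * \<i> * \<eta> * H 0)) (at 0)"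
    by (auto intro!: derivative_eq_intros D0)
  then have "((\<lambda>x. B (a + x)) has_field_derivative c * (- 2 * of_real pi * \<i> * \<eta> * H 0)) (at 0)"
    by (simp add: c(2)[abs_def])
  then have "(B has_field_derivative c * (- 2 * of_real pi * \<i> * \<eta> * H 0)) (at (a + 0))"
    using DERIV_shift[of B _ 0 a] by (simp add: add.commute)
  then show ?thesis using c(1) H0 eta_nz
    by (intro exI[of _ "c * (- 2 * of_real pi * \<i> * \<eta> * H 0)"]) simp
qed

section \<open>Theta functions of higher order\<close>

text \<open>The multipliers are those of a product of \<open>N\<close> factors \<open>[x - a\<^sub>i]\<close> with \<open>a\<^sub>1 + \<dots> + a\<^sub>N = t\<close>.\<close>

definition theta_fun :: "nat \<Rightarrow> complex \<Rightarrow> (complex \<Rightarrow> complex) \<Rightarrow> bool" where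
  "theta_fun N t f \<longleftrightarrow> f holomorphic_on UNIV \<and> (\<forall>x. f (x + 1 / \<eta>) = (- 1) ^ N * f x) \<and>
    (\<forall>x. f (x + \<tau> / \<eta>) =
      (- 1) ^ N * exp (- 2 * of_real pi * \<i> * \<eta> * (of_nat N * x - t) - of_nat N * of_real pi * \<i> * \<tau>) * f x)"

lemma theta_fun_B: "theta_fun 1 a (\<lambda>x. B (x - a))"
  unfolding theta_fun_def
  using B_period1[of "_ - a"] B_period2[of "_ - a"]
  by (auto intro!: holomorphic_intros simp: algebra_simps)

lemma theta_fun_B_shift: "theta_fun 1 (a - b) (\<lambda>x. B (x + b - a))"
  using theta_fun_B[of "a - b"] by (simp add: algebra_simps)

lemma theta_fun_cmult: "theta_fun N t f \<Longrightarrow> theta_fun N t (\<lambda>x. c * f x)"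
  unfolding theta_fun_def by (auto intro!: holomorphic_intros)

lemma theta_fun_minus: "theta_fun N t f \<Longrightarrow> theta_fun N t (\<lambda>x. - f x)"
  using theta_fun_cmult[of N t f "-1"] by simp

lemma theta_fun_B_neg: "theta_fun 1 a (\<lambda>x. B (a - x))"
  using theta_fun_minus[OF theta_fun_B[of a]] by (simp add: B_minus[symmetric])

lemma theta_fun_const: "theta_fun 0 0 (\<lambda>x. c)"
  unfolding theta_fun_def by auto

lemma theta_fun_mult:
  assumes "theta_fun N t f" "theta_fun M s g"
  shows "theta_fun (N + M) (t + s) (\<lambda>x. f x * g x)"
proof -
  have "exp (- 2 * of_real pi * \<i> * \<eta> * (of_nat (N + M) * x - (t + s)) - of_nat (N + M) * of_real pi * \<i> * \<tau>)
    = exp (- 2 * of_real pi * \<i> * \<eta> * (of_nat N * x - t) - of_nat N * of_real pi * \<i> * \<tau>)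
     * exp (- 2 * of_real pi * \<i> * \<eta> * (of_nat M * x - s) - of_nat M * of_real pi * \<i> * \<tau>)" for x
    unfolding exp_add[symmetric] by (rule arg_cong[where f = exp]) (simp add: algebra_simps)
  then show ?thesis
    using assms unfolding theta_fun_def
    by (auto intro!: holomorphic_intros simp: power_add mult_ac)
qed

lemma theta_fun_add: "theta_fun N t f \<Longrightarrow> theta_fun N t g \<Longrightarrow> theta_fun N t (\<lambda>x. f x + g x)"
  unfolding theta_fun_def by (auto intro!: holomorphic_intros simp: ring_distribs)

lemma theta_fun_diff: "theta_fun N t f \<Longrightarrow> theta_fun N t g \<Longrightarrow> theta_fun N t (\<lambda>x. f x - g x)"
  using theta_fun_add[of N t f "\<lambda>x. - g x"] theta_fun_minus[of N t g] by simp

lemma theta_fun_zero: "theta_fun N t (\<lambda>x. 0)"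
  unfolding theta_fun_def by auto

lemma theta_fun_sum: "(\<And>i. i \<in> I \<Longrightarrow> theta_fun N t (f i)) \<Longrightarrow> theta_fun N t (\<lambda>x. \<Sum>i\<in>I. f i x)"
  by (induction I rule: infinite_finite_induct) (auto intro: theta_fun_add theta_fun_zero)

lemma theta_fun_prod:
  "finite I \<Longrightarrow> (\<And>i. i \<in> I \<Longrightarrow> theta_fun 1 (t i) (f i)) \<Longrightarrow> theta_fun (card I) (\<Sum>i\<in>I. t i) (\<lambda>x. \<Prod>i\<in>I. f i x)"
proof (induction I rule: finite_induct)
  case empty
  show ?case using theta_fun_const[of 1] by simp
next
  case (insert i I)
  then show ?case using theta_fun_mult[of 1 "t i" "f i" "card I"] by simp
qed

text \<open>The zeros of [x - a] form the coset of a modulo the lattice. Quasi-periodicity spreads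
  the zero of \<open>f\<close> over this coset, and since [x - a] has only simple zeros the quotient
  is entire. Its multipliers are the quotients of the given ones.\<close>

lemma theta_fun_divide_B:
  assumes f: "theta_fun (Suc N) t f" and fa: "f a = 0"
  shows "\<exists>g. theta_fun N (t - a) g \<and> (\<forall>x. f x = B (x - a) * g x)"
proof -
  have hf: "f holomorphic_on UNIV" using f by (simp add: theta_fun_def)
  have f0: "f x = 0" if "B (x - a) = 0" for x
  proof -
    \<comment> \<open>The translations preserving the zero set of \<open>f\<close> form a group
      containing both quasi-periods, hence the whole lattice.\<close>
    define T where "T b \<longleftrightarrow> (\<forall>x. f (x + b) = 0 \<longleftrightarrow> f x = 0)" for b
    have Tadd: "T (b + c)" if "T b" "T c" for b c
      using that unfolding T_def by (metis add.assoc)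
    have Tneg: "T (- b)" if "T b" for b
      using that unfolding T_def by (metis add.right_neutral add.right_inverse add.assoc add.commute)
    have T0: "T 0" unfolding T_def by simp
    have Tint: "T (of_int k * b)" if "T b" for k b
    proof (induction k rule: int_induct[where k = 0])
      case (step1 k)
      then show ?case using Tadd[OF _ that] by (simp add: ring_distribs)
    next
      case (step2 k)
      then show ?case using Tadd[OF _ Tneg[OF that]] by (simp add: ring_distribs)
    qed (simp add: T0)
    have "T (1 / \<eta>)" "T (\<tau> / \<eta>)" using f unfolding theta_fun_def T_def by auto
    moreover obtain k l where kl: "\<eta> * (x - a) = of_int k + \<tau> * of_int l"
      using \<open>B (x - a) = 0\<close> B_eq_0_iff by blast
    then have "x - a = of_int k * (1 / \<eta>) + of_int l * (\<tau> / \<eta>)" using eta_nz by (simp add: field_simps)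
    ultimately have "T (x - a)" by (metis Tint Tadd)
    then have "f (a + (x - a)) = 0 \<longleftrightarrow> f a = 0" unfolding T_def by blast
    then show ?thesis using fa by simp
  qed
  \<comment> \<open>At a zero of [x - a] the value is the limit of the quotient, obtained below by
    dividing difference quotients.\<close>
  define g where "g x = (if B (x - a) = 0 then deriv f x / deriv B (x - a) else f x / B (x - a))" for x
  have fg: "f x = B (x - a) * g x" for x
    using f0[of x] by (simp add: g_def)
  have hg: "g field_differentiable (at z)" for z
  proof -
    have "\<forall>\<^sub>F x in at z. B (x - a) \<noteq> 0"
    proof (cases "B (z - a) = 0")
      case False
      have "isCont (\<lambda>x. B (x - a)) z" by (intro continuous_intros)
      then show ?thesis using False by (metis isCont_def tendsto_imp_eventually_ne)
    next
      case True
      obtain D where D: "D \<noteq> 0" "(B has_field_derivative D) (at (z - a))"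
        using B_has_derivative_at_zero[OF True] by blast
      then have "((\<lambda>x. B (x - a)) has_field_derivative D) (at z)"
        using DERIV_shift[of B D z "- a"] by simp
      then have "((\<lambda>x. (B (x - a) - B (z - a)) / (x - z)) \<longlongrightarrow> D) (at z)"
        by (simp add: has_field_derivative_iff)
      then have "\<forall>\<^sub>F x in at z. (B (x - a) - B (z - a)) / (x - z) \<noteq> 0"
        using D(1) by (metis tendsto_imp_eventually_ne)
      then show ?thesis by (rule eventually_mono) (use True in auto)
    qed
    then obtain e where e: "e > 0" "\<And>x. x \<noteq> z \<Longrightarrow> dist x z < e \<Longrightarrow> B (x - a) \<noteq> 0"
      by (auto simp: eventually_at)
    have "g holomorphic_on ball z e"
    proof (rule no_isolated_singularity'[where K = "{z}"])
      have "(\<lambda>x. f x / B (x - a)) holomorphic_on ball z e - {z}"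
        by (intro holomorphic_intros holomorphic_on_subset[OF hf]) (use e in \<open>auto simp: dist_commute\<close>)
      then show "g holomorphic_on ball z e - {z}"
        by (rule holomorphic_transform) (use e in \<open>auto simp: dist_commute g_def\<close>)
      show "(g \<longlongrightarrow> g z') (at z' within ball z e)" if "z' \<in> {z}" for z'
      proof -
        have ev: "\<forall>\<^sub>F x in at z. g x = f x / B (x - a)"
          using \<open>\<forall>\<^sub>F x in at z. B (x - a) \<noteq> 0\<close> by (rule eventually_mono) (simp add: g_def)
        have "((\<lambda>x. f x / B (x - a)) \<longlongrightarrow> g z) (at z)"
        proof (cases "B (z - a) = 0")
          case False
          have "isCont f z"
            using holomorphic_on_imp_continuous_on[OF hf] by (simp add: continuous_on_eq_continuous_at)
          then have "isCont (\<lambda>x. f x / B (x - a)) z"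
            using False by (intro continuous_intros) auto
          then show ?thesis using False by (simp add: isCont_def g_def)
        next
          case True
          obtain D where D: "D \<noteq> 0" "(B has_field_derivative D) (at (z - a))"
            using B_has_derivative_at_zero[OF True] by blast
          then have "((\<lambda>x. B (x - a)) has_field_derivative D) (at z)"
            using DERIV_shift[of B D z "- a"] by simp
          then have 1: "((\<lambda>x. (B (x - a) - B (z - a)) / (x - z)) \<longlongrightarrow> D) (at z)"
            by (simp add: has_field_derivative_iff)
          have "(f has_field_derivative deriv f z) (at z)"
            using hf by (simp add: holomorphic_derivI)
          then have 2: "((\<lambda>x. (f x - f z) / (x - z)) \<longlongrightarrow> deriv f z) (at z)"
            by (simp add: has_field_derivative_iff)
          have 3: "((\<lambda>x. ((f x - f z) / (x - z)) / ((B (x - a) - B (z - a)) / (x - z))) \<longlongrightarrow> deriv f z / D) (at z)"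
            by (rule tendsto_divide[OF 2 1 D(1)])
          have "deriv f z / D = g z" using True D(2) by (simp add: g_def DERIV_imp_deriv)
          moreover have "\<forall>\<^sub>F x in at z. ((f x - f z) / (x - z)) / ((B (x - a) - B (z - a)) / (x - z)) = f x / B (x - a)"
            using f0[OF True] True by (auto simp: eventually_at_filter)
          ultimately show ?thesis using 3 tendsto_cong by force
        qed
        then have "(g \<longlongrightarrow> g z) (at z)" using ev tendsto_cong by force
        from tendsto_within_subset[OF this, of "ball z e"] show ?thesis using that by simp
      qed
    qed auto
    then show ?thesis using e(1) by (meson centre_in_ball holomorphic_on_imp_differentiable_at open_ball)
  qed
  then have hg': "g holomorphic_on UNIV" by (simp add: holomorphic_on_def field_differentiable_at_within)
  have cz: "countable {x. B (x - a) = 0}"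
    using countable_B_zeros[of 1 "- a"] by (simp add: add.commute)
  have cg: "isCont g x" for x
    using holomorphic_on_imp_continuous_on[OF hg'] by (simp add: continuous_on_eq_continuous_at)
  have cg': "isCont (\<lambda>x. g (x + b)) x" for x b
    by (rule isCont_o2[OF _ cg]) (intro continuous_intros)
  \<comment> \<open>The factor [x - a] can be cancelled only where it is nonzero; continuity covers
    the countable rest. The same holds for the second multiplier.\<close>
  have "g (x + 1 / \<eta>) - (- 1) ^ N * g x = 0" for x
  proof (rule isCont_eq_off_countable[where f = "\<lambda>x. g (x + 1 / \<eta>) - (- 1) ^ N * g x", OF _ cz])
    show "isCont (\<lambda>x. g (x + 1 / \<eta>) - (- 1) ^ N * g x) x"
      by (intro continuous_intros cg cg')
    fix s assume "s \<notin> {x. B (x - a) = 0}"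
    then have "B (s - a) \<noteq> 0" by simp
    moreover have "f (s + 1 / \<eta>) = (- 1) ^ Suc N * f s" using f by (simp add: theta_fun_def)
    then have "B (s - a) * g (s + 1 / \<eta>) = B (s - a) * ((- 1) ^ N * g s)"
      using B_period1[of "s - a"] by (simp add: fg algebra_simps)
    ultimately show "g (s + 1 / \<eta>) - (- 1) ^ N * g s = 0" by simp
  qed
  moreover
  have "g (x + \<tau> / \<eta>) - (- 1) ^ N * exp (- 2 * of_real pi * \<i> * \<eta> * (of_nat N * x - (t - a)) - of_nat N * of_real pi * \<i> * \<tau>) * g x = 0" for x
  proof (rule isCont_eq_off_countable[where f = "\<lambda>x. g (x + \<tau> / \<eta>) - (- 1) ^ N * exp (- 2 * of_real pi * \<i> * \<eta> * (of_nat N * x - (t - a)) - of_nat N * of_real pi * \<i> * \<tau>) * g x", OF _ cz])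
    show "isCont (\<lambda>x. g (x + \<tau> / \<eta>) - (- 1) ^ N * exp (- 2 * of_real pi * \<i> * \<eta> * (of_nat N * x - (t - a)) - of_nat N * of_real pi * \<i> * \<tau>) * g x) x"
      by (intro continuous_intros cg cg')
    fix s assume "s \<notin> {x. B (x - a) = 0}"
    then have nz: "B (s - a) \<noteq> 0" by simp
    define e1 where "e1 = exp (- 2 * of_real pi * \<i> * \<eta> * (s - a) - of_real pi * \<i> * \<tau>)"
    define e2 where "e2 = exp (- 2 * of_real pi * \<i> * \<eta> * (of_nat N * s - (t - a)) - of_nat N * of_real pi * \<i> * \<tau>)"
    have "f (s + \<tau> / \<eta>) = (- 1) ^ Suc N * exp (- 2 * of_real pi * \<i> * \<eta> * (of_nat (Suc N) * s - t) - of_nat (Suc N) * of_real pi * \<i> * \<tau>) * f s"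
      using f unfolding theta_fun_def by blast
    also have "exp (- 2 * of_real pi * \<i> * \<eta> * (of_nat (Suc N) * s - t) - of_nat (Suc N) * of_real pi * \<i> * \<tau>) = e1 * e2"
      unfolding e1_def e2_def exp_add[symmetric] by (rule arg_cong[where f = exp]) (simp add: algebra_simps)
    finally have "B (s + \<tau> / \<eta> - a) * g (s + \<tau> / \<eta>) = (- 1) ^ Suc N * (e1 * e2) * (B (s - a) * g s)"
      unfolding fg .
    moreover have "B (s + \<tau> / \<eta> - a) = - e1 * B (s - a)"
      using B_period2[of "s - a"] unfolding e1_def by (simp add: algebra_simps)
    ultimately have "- e1 * B (s - a) * g (s + \<tau> / \<eta>) = - e1 * B (s - a) * ((- 1) ^ N * e2 * g s)"
      by (simp add: mult_ac)
    moreover have "- e1 * B (s - a) \<noteq> 0" using nz by (simp add: e1_def)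
    ultimately have "g (s + \<tau> / \<eta>) = (- 1) ^ N * e2 * g s" by (metis mult_left_cancel)
    then show "g (s + \<tau> / \<eta>) - (- 1) ^ N * exp (- 2 * of_real pi * \<i> * \<eta> * (of_nat N * s - (t - a)) - of_nat N * of_real pi * \<i> * \<tau>) * g s = 0"
      by (simp add: e2_def)
  qed
  ultimately have "theta_fun N (t - a) g" unfolding theta_fun_def using hg' by simp
  then show ?thesis using fg by blast
qed

text \<open>After multiplication by a suitable exponential both multipliers have modulus 1, so that
  Liouville's theorem applies.\<close>

lemma theta_fun_0_eq_0:
  assumes f: "theta_fun 0 t f" and t: "B t \<noteq> 0"
  shows "f x = 0"
proof -
  have hf: "f holomorphic_on UNIV" and f1: "\<And>x. f (x + 1 / \<eta>) = f x"
    and f2: "\<And>x. f (x + \<tau> / \<eta>) = exp (2 * of_real pi * \<i> * \<eta> * t) * f x"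
    using f unfolding theta_fun_def by auto
  \<comment> \<open>Since \<open>b\<close> is real, the step 1 / \<eta> changes the exponential by a
    factor of modulus 1. Its value is chosen so that at the step \<tau> / \<eta> the modulus of
    \<open>exp (2 * of_real pi * \<i> * \<eta> * t)\<close> is cancelled.\<close>
  define b where "b = - 2 * pi * Im (\<eta> * t) / Im \<tau>"
  define F where "F x = f x * exp (\<i> * of_real b * (\<eta> * x))" for x
  have F1: "norm (F (x + 1 / \<eta>)) = norm (F x)" for x
    unfolding F_def using eta_nz by (simp add: f1 norm_mult ring_distribs exp_add)
  have F2: "norm (F (x + \<tau> / \<eta>)) = norm (F x)" for x
  proof -
    have "Re (2 * of_real pi * \<i> * \<eta> * t) + Re (\<i> * of_real b * \<tau>) = 0"
      using Im_tau by (simp add: b_def field_simps)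
    then have "norm (exp (2 * of_real pi * \<i> * \<eta> * t)) * norm (exp (\<i> * of_real b * \<tau>)) = 1"
      unfolding norm_exp_eq_Re exp_add[symmetric] by simp
    moreover have "F (x + \<tau> / \<eta>) = (exp (2 * of_real pi * \<i> * \<eta> * t) * exp (\<i> * of_real b * \<tau>)) * F x"
      unfolding F_def f2 using eta_nz by (simp add: ring_distribs exp_add)
    ultimately show ?thesis by (metis mult_1 norm_mult)
  qed
  have shift: "norm (F (x + of_int k * w)) = norm (F x)" if "\<And>x. norm (F (x + w)) = norm (F x)" for x k w
  proof (induction k rule: int_induct[where k = 0])
    case (step1 k)
    then show ?case using that[of "x + of_int k * w"] by (simp add: ring_distribs add_ac)
  next
    case (step2 k)
    then show ?case using that[of "x + of_int (k - 1) * w"] by (simp add: ring_distribs add_ac)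
  qed simp
  have hF: "F holomorphic_on UNIV" unfolding F_def by (intro holomorphic_intros hf)
  \<comment> \<open>A closed fundamental parallelogram, on which \<open>F\<close> is bounded by
    compactness.\<close>
  let ?K = "(\<lambda>(s, r). (of_real s + of_real r * \<tau>) / \<eta>) ` ({0..1} \<times> {0..1 :: real})"
  have "compact ?K"
    by (intro compact_continuous_image compact_Times)
      (use eta_nz in \<open>auto intro!: continuous_intros simp: case_prod_unfold\<close>)
  then have "compact (F ` ?K)"
    using hF holomorphic_on_imp_continuous_on continuous_on_subset compact_continuous_image by blast
  then have "bounded (F ` ?K)" by (rule compact_imp_bounded)
  then obtain M where bnd: "\<forall>y\<in>F ` ?K. norm y \<le> M"
    unfolding bounded_iff by (elim exE)
  have M: "norm (F y) \<le> M" if "y \<in> ?K" for y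
    by (rule bspec[OF bnd imageI[OF that]])
  have "norm (F x) \<le> M" for x
  proof -
    define r where "r = Im (\<eta> * x) / Im \<tau>"
    define s where "s = Re (\<eta> * x) - r * Re \<tau>"
    have "\<eta> * x = of_real s + of_real r * \<tau>"
      using Im_tau by (simp add: complex_eq_iff r_def s_def)
    then have x: "x = (of_real s + of_real r * \<tau>) / \<eta>" using eta_nz by (simp add: field_simps)
    let ?y = "(of_real (frac s) + of_real (frac r) * \<tau>) / \<eta>"
    have "s = frac s + of_int \<lfloor>s\<rfloor>" "r = frac r + of_int \<lfloor>r\<rfloor>" by (simp_all add: frac_def)
    then have "x = ?y + of_int \<lfloor>s\<rfloor> * (1 / \<eta>) + of_int \<lfloor>r\<rfloor> * (\<tau> / \<eta>)"
      unfolding x using eta_nz by (simp add: field_simps frac_def)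
    then have "norm (F x) = norm (F ?y)"
      using shift[of "1 / \<eta>" ?y "\<lfloor>s\<rfloor>"] shift[of "\<tau> / \<eta>" "?y + of_int \<lfloor>s\<rfloor> * (1 / \<eta>)" "\<lfloor>r\<rfloor>"] F1 F2 by simp
    moreover have "?y \<in> ?K"
      by (rule image_eqI[of _ _ "(frac s, frac r)"]) (auto simp: frac_lt_1 less_imp_le)
    ultimately show ?thesis using M by metis
  qed
  then have "bounded (range F)" unfolding bounded_iff by blast
  then obtain c where c: "\<And>x. F x = c"
    using Liouville_theorem[OF hF] by (auto simp: constant_on_def)
  have "c = 0"
  proof (rule ccontr)
    \<comment> \<open>Now \<open>f\<close> is a pure exponential. Its first multiplier makes
      \<open>b\<close> an integer multiple of 2 \<pi>, and the second then places \<eta> t in the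
      lattice.\<close>
    assume c0: "c \<noteq> 0"
    have f: "f x = c * exp (- (\<i> * of_real b * (\<eta> * x)))" for x
      using c[of x] by (simp add: F_def exp_minus field_simps)
    have "exp (- (\<i> * of_real b)) = 1"
      using f1[of 0] eta_nz c0 by (simp add: f)
    then obtain k :: int where "- (\<i> * of_real b) = 2 * of_real pi * \<i> * of_int k"
      using exp_eq[of "- (\<i> * of_real b)" 0] by (auto simp: mult_ac)
    then have k: "\<i> * of_real b = - 2 * of_real pi * \<i> * of_int k" by (metis minus_minus mult_minus_left)
    have "exp (- (\<i> * of_real b * \<tau>)) = exp (2 * of_real pi * \<i> * \<eta> * t)"
      using f2[of 0] eta_nz c0 by (simp add: f)
    then obtain m :: int where "2 * of_real pi * \<i> * \<eta> * t = - (\<i> * of_real b * \<tau>) + (of_int (2 * m) * pi) * \<i>"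
      using exp_eq[of "2 * of_real pi * \<i> * \<eta> * t"] by metis
    then have "(2 * of_real pi * \<i>) * (\<eta> * t) = (2 * of_real pi * \<i>) * (of_int m + \<tau> * of_int k)"
      unfolding k by (simp add: algebra_simps)
    then have "\<eta> * t = of_int m + \<tau> * of_int k" by simp
    then show False using t B_eq_0_iff by blast
  qed
  then show ?thesis using c[of x] by (simp add: F_def)
qed

text \<open>One listed zero is divided out at a time. The \<open>sorted_wrt\<close> condition
  expresses pairwise incongruence, which keeps the remaining points zeros of the quotient. At the
  end the order is 0 and the parameter is t minus the sum of the zeros.\<close>

lemma theta_fun_eq_0:
  assumes "theta_fun (length ps) t f" "\<And>a. a \<in> set ps \<Longrightarrow> f a = 0"
    "sorted_wrt (\<lambda>a b. B (b - a) \<noteq> 0) ps" "B (t - sum_list ps) \<noteq> 0"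
  shows "f x = 0"
  using assms
proof (induction ps arbitrary: t f x)
  case Nil
  then show ?case using theta_fun_0_eq_0 by simp
next
  case (Cons a ps)
  obtain g where g: "theta_fun (length ps) (t - a) g" "\<And>x. f x = B (x - a) * g x"
    using theta_fun_divide_B[of "length ps" t f a] Cons.prems by auto
  have "g x = 0"
  proof (rule Cons.IH[OF g(1)])
    show "g b = 0" if "b \<in> set ps" for b
      using Cons.prems(2,3) that g(2)[of b] by auto
  qed (use Cons.prems in \<open>auto simp: algebra_simps\<close>)
  then show ?case using g(2) by simp
qed

text \<open>Weierstrass's addition formula. In x all three terms have order 2 and zero sum 0, so the
  two zeros z and w of the difference suffice, provided [z + w] and [z - w] are nonzero; continuity
  in z covers the other cases.\<close>

lemma three_term:
  "B (x + z) * B (x - z) * B (y + w) * B (y - w) - B (x + w) * B (x - w) * B (y + z) * B (y - z)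
    = B (x + y) * B (x - y) * B (z + w) * B (z - w)"
proof -
  define F where "F z x = B (x + z) * B (x - z) * B (y + w) * B (y - w) - B (x + w) * B (x - w) * B (y + z) * B (y - z)
    - B (x + y) * B (x - y) * B (z + w) * B (z - w)" for z x
  have gen: "F z x = 0" if nz: "B (z + w) \<noteq> 0" "B (z - w) \<noteq> 0" for z
  proof -
    have 2: "theta_fun 2 0 (\<lambda>x. B (x + a) * B (x - a) * c * d)" for a c d
    proof -
      have "theta_fun 2 0 (\<lambda>x. (c * d) * (B (x + a) * B (x - a)))"
        using theta_fun_cmult[OF theta_fun_mult[OF theta_fun_B[of "- a"] theta_fun_B[of a]]] by (simp add: numeral_2_eq_2)
      then show ?thesis by (simp add: mult_ac)
    qed
    have "theta_fun (length [z, w]) 0 (F z)"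
      unfolding F_def using theta_fun_diff[OF theta_fun_diff[OF 2 2] 2] by (simp add: numeral_2_eq_2)
    then show ?thesis
    proof (rule theta_fun_eq_0)
      have "B (w - z) \<noteq> 0" using nz(2) B_minus[of "z - w"] by simp
      then show "sorted_wrt (\<lambda>a b. B (b - a) \<noteq> 0) [z, w]" by simp
      show "B (0 - sum_list [z, w]) \<noteq> 0" using nz(1) B_minus[of "z + w"] by (simp add: algebra_simps)
      show "F z a = 0" if "a \<in> set [z, w]" for a
        using that B_minus[of "y - z"] B_minus[of "y - w"] B_minus[of "w - z"] by (auto simp: F_def algebra_simps)
    qed
  qed
  have "F z x = 0"
  proof (rule isCont_eq_off_countable[where f = "\<lambda>z. F z x"])
    show "isCont (\<lambda>z. F z x) z" unfolding F_def by (intro continuous_intros)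
    show "countable ({z. B (w + of_int 1 * z) = 0} \<union> {z. B (- w + of_int 1 * z) = 0})"
      by (intro countable_Un countable_B_zeros) simp_all
  qed (use gen in \<open>auto simp: add.commute\<close>)
  then show ?thesis by (simp add: F_def)
qed

section \<open>The dynamical Yang-Baxter equation\<close>

text \<open>The substitution \<open>z = m/2, x = z + q, y = z + s, w = z + d\<close> keeps halves out of the arguments.\<close>

lemma three_term_shift:
  "B (m + q) * B q * B (m + s + d) * B (s - d) - B (m + q + d) * B (q - d) * B (m + s) * B s
    = - (B (m + q + s) * B (q - s) * B (m + d) * B d)"
  using three_term[of "m / 2 + q" "m / 2" "m / 2 + s" "m / 2 + d"] B_minus[of d]
  by (simp add: algebra_simps flip: add_divide_distrib mult_2)

text \<open>Blocks with non-adjacent entries get weight \<open>0\<close>, so adjacency constraints may be dropped from sums.\<close>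

definition W :: "complex \<Rightarrow> int \<Rightarrow> int \<Rightarrow> int \<Rightarrow> int \<Rightarrow> complex \<Rightarrow> complex" where
  "W l a b c d u = Rmat \<tau> \<eta> (b - a) (d - b) (d - c) (c - a) (l + of_int a) u"

lemma W_shift: "W l (a + i) (a + j) (a + k) (a + m) u = W (l + of_int a) i j k m u"
  by (simp add: W_def add_ac)

text \<open>This symmetry exchanges + and - in the R-matrix and halves the case distinction in the
  Yang-Baxter equation.\<close>

lemma W_neg: "W l (- a) (- b) (- c) (- d) u = W (- l) a b c d u"
  using B_minus[of "l - of_int a"] B_minus[of "l - of_int a - 1"] B_minus[of "l - of_int a + 1"]
    B_minus[of "l - of_int a - u"] B_minus[of "l - of_int a + u"]
  by (auto simp: W_def Rmat_def algebra_simps)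

lemma W_nonzero_adjacent:
  assumes "W l a b c d u \<noteq> 0"
  shows "\<bar>b - a\<bar> = 1" "\<bar>d - b\<bar> = 1" "\<bar>d - c\<bar> = 1" "\<bar>c - a\<bar> = 1"
  using assms by (auto simp: W_def Rmat_def split: if_splits)

text \<open>The heights 0, b, c, c', b'', a' run round a hexagon in unit steps; with an upward first
  step there are ten closed patterns. In three of them each side has a single admissible term, in
  six one three-term relation suffices, and the alternating pattern 0, 1, 0, 1, 0, 1 takes
  two.\<close>

lemma yang_baxter_aux:
  fixes b c c' b'' a' :: int and l u v w :: complex
  assumes nz: "\<And>k :: int. B (l + of_int k) \<noteq> 0" and b: "b = 1" and u: "u = v + w"
    and adj: "\<bar>c - b\<bar> = 1" "\<bar>c' - c\<bar> = 1" "\<bar>b'' - c'\<bar> = 1" "\<bar>a' - b''\<bar> = 1" "\<bar>a'\<bar> = 1"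
  shows "W l 0 b a' (a' - 1) u * W l b c (a' - 1) c' v * W l a' (a' - 1) b'' c' w
     + W l 0 b a' (a' + 1) u * W l b c (a' + 1) c' v * W l a' (a' + 1) b'' c' w
   = W l 0 b (-1) c w * W l 0 (-1) a' b'' v * W l (-1) c b'' c' u
     + W l 0 b 1 c w * W l 0 1 a' b'' v * W l 1 c b'' c' u"
proof -
  have n0: "B l \<noteq> 0" "B (l + 1) \<noteq> 0" "B (l - 1) \<noteq> 0" "B 1 \<noteq> 0"
    using nz[of 0] nz[of 1] nz[of "-1"] B_1 by simp_all
  note s = W_def Rmat_def
  have "(c, c', b'', a') \<in> {(2,3,2,1), (2,1,2,1), (2,1,0,1), (2,1,0,-1), (0,1,2,1), (0,1,0,1), (0,1,0,-1),
      (0,-1,0,1), (0,-1,0,-1), (0,-1,-2,-1)}"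
    using adj b by (auto simp: abs_if split: if_splits)
  then consider "c = 2" "c' = 3" "b'' = 2" "a' = 1" | "c = 2" "c' = 1" "b'' = 2" "a' = 1"
    | "c = 2" "c' = 1" "b'' = 0" "a' = 1" | "c = 2" "c' = 1" "b'' = 0" "a' = -1"
    | "c = 0" "c' = 1" "b'' = 2" "a' = 1" | "c = 0" "c' = 1" "b'' = 0" "a' = 1"
    | "c = 0" "c' = 1" "b'' = 0" "a' = -1" | "c = 0" "c' = -1" "b'' = 0" "a' = 1"
    | "c = 0" "c' = -1" "b'' = 0" "a' = -1" | "c = 0" "c' = -1" "b'' = -2" "a' = -1"
    by auto
  then show ?thesis
  proof cases
    case 1
    then show ?thesis by (simp add: s b)
  next
    case 2
    then show ?thesis
      using three_term_shift[of "w - v" "l - w + 1" "v + 1" v] n0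
      by (simp add: s b u divide_simps) (simp add: algebra_simps)
  next
    case 3
    then show ?thesis
      using arg_cong[where f = "\<lambda>z. z * B (l + 2)", OF three_term_shift[of "1 - v" l u v]] n0
      by (simp add: s b u divide_simps) (simp add: algebra_simps)
  next
    case 4
    then show ?thesis using n0 by (simp add: s b u field_simps)
  next
    case 5
    then show ?thesis
      using three_term_shift[of "1 - w" l u w] n0
      by (simp add: s b u divide_simps) (simp add: algebra_simps)
  next
    case 6
    \<comment> \<open>The factor \<open>B (2 * l + 1)\<close> does not occur in the equation to be
      proved; it is common to \<open>k1\<close> and \<open>k2\<close> and is eliminated between
      them.\<close>
    have k1: "B (l + 1) ^ 3 * B (l - 1) - B (l + 2) * B l ^ 3 = - (B 1 ^ 3 * B (2 * l + 1))"
      using three_term[of "l + 1" 0 l 1] B_minus[of 1] by (simp add: algebra_simps power3_eq_cube)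
    have k2: "B (2 * l + 1) * B (u + 1) * B v * B w
       = B (l + 1) * B (l - w) * B (l - v) * B (l + 1 + u) - B l * B (l - u) * B (l + 1 + v) * B (l + 1 + w)"
      using three_term_shift[of "v + 1" l "l - v" w] u by (simp add: algebra_simps)
    have alg: "lu / l0 * (lv / l1) * (lw / l1) + u1 / o1 * (v0 * l0 / (o1 * l1)) * (w0 * l2 / (o1 * l1))
      = w0 * l1 / (o1 * l0) * (v0 * lm / (o1 * l0)) * (u1 / o1) + lw' / l0 * (lv' / l0) * (lu' / l1)"
      if "l0 \<noteq> 0" "l1 \<noteq> 0" "o1 \<noteq> 0" "l1 ^ 3 * lm - l2 * l0 ^ 3 = - (o1 ^ 3 * h)"
        "h * u1 * v0 * w0 = l1 * lw' * lv' * lu' - l0 * lu * lv * lw"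
      for l0 l1 l2 lm o1 h u1 v0 w0 lu lv lw lu' lv' lw' :: complex
    proof -
      have "o1 ^ 3 * (l1 * lw' * lv' * lu' - l0 * lu * lv * lw) = (l2 * l0 ^ 3 - l1 ^ 3 * lm) * u1 * v0 * w0"
      proof -
        have "h * o1 ^ 3 = l2 * l0 ^ 3 - l1 ^ 3 * lm" using that(4) by (simp add: algebra_simps)
        moreover have "o1 ^ 3 * (h * u1 * v0 * w0) = (h * o1 ^ 3) * u1 * v0 * w0" by (simp add: mult_ac)
        ultimately show ?thesis by (simp add: that(5))
      qed
      then show ?thesis using that(1-3)
        by (simp add: divide_simps power3_eq_cube) (simp add: algebra_simps)
    qed
    show ?thesis
      using 6 alg[OF n0(1,2,4) k1 k2] by (simp add: s b algebra_simps)
  next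
    case 7
    then show ?thesis
      using three_term_shift[of "v - 1" "l + 1" "w + 1" 1] n0
      by (simp add: s b u divide_simps) (simp add: algebra_simps)
  next
    case 8
    then show ?thesis
      using three_term_shift[of "v - w" "l - v" "w + 1" w] n0
      by (simp add: s b u divide_simps) (simp add: algebra_simps)
  next
    case 9
    then show ?thesis
      using arg_cong[where f = "\<lambda>z. z * B (l + 1)", OF three_term_shift[of "1 - w" "l - 1" u w]] n0
      by (simp add: s b u divide_simps) (simp add: algebra_simps)
  next
    case 10
    then show ?thesis using n0 by (simp add: s b u field_simps)
  qed
qed

text \<open>The sums run over the height at the centre of the hexagon, which is adjacent to a' on
  the left-hand side and to a on the right-hand side. Non-adjacent heights on the boundary kill all
  terms; otherwise \<open>W_shift\<close> moves a to 0, and \<open>W_neg\<close> makes the first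
  step go up.\<close>

lemma yang_baxter:
  fixes a b c c' b'' a' :: int and l u v w :: complex
  assumes nz: "\<And>k :: int. B (l + of_int k) \<noteq> 0" and u: "u = v + w"
  shows "(\<Sum>b'\<in>{a' - 1, a' + 1}. W l a b a' b' u * W l b c b' c' v * W l a' b' b'' c' w)
    = (\<Sum>b'\<in>{a - 1, a + 1}. W l a b b' c w * W l a b' a' b'' v * W l b' c b'' c' u)"
proof (cases "\<bar>b - a\<bar> = 1 \<and> \<bar>c - b\<bar> = 1 \<and> \<bar>c' - c\<bar> = 1 \<and> \<bar>b'' - c'\<bar> = 1 \<and> \<bar>a' - b''\<bar> = 1 \<and> \<bar>a' - a\<bar> = 1")
  case False
  have "W l a b a' b' u * W l b c b' c' v * W l a' b' b'' c' w = 0" for b'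
    using False W_nonzero_adjacent by (metis abs_minus_commute mult_eq_0_iff)
  moreover have "W l a b b' c w * W l a b' a' b'' v * W l b' c b'' c' u = 0" for b'
    using False W_nonzero_adjacent by (metis abs_minus_commute mult_eq_0_iff)
  ultimately show ?thesis by (simp only: sum.neutral_const)
next
  case True
  have main: "(\<Sum>b'\<in>{a' - 1, a' + 1}. W l 0 1 a' b' u * W l 1 c b' c' v * W l a' b' b'' c' w)
    = (\<Sum>b'\<in>{-1, 1}. W l 0 1 b' c w * W l 0 b' a' b'' v * W l b' c b'' c' u)"
    if "\<And>k :: int. B (l + of_int k) \<noteq> 0"
      "\<bar>c - 1\<bar> = 1" "\<bar>c' - c\<bar> = 1" "\<bar>b'' - c'\<bar> = 1" "\<bar>a' - b''\<bar> = 1" "\<bar>a'\<bar> = 1"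
    for l and c c' b'' a' :: int
    using yang_baxter_aux[OF that(1) refl u that(2-)] by simp
  have nz': "B (l + of_int a + of_int k) \<noteq> 0" for k
    using nz[of "a + k"] by (simp add: add_ac)
  have sh: "W l b1 b2 b3 b4 z = W (l + of_int a) (b1 - a) (b2 - a) (b3 - a) (b4 - a) z" for b1 b2 b3 b4 z
    using W_shift[of l a "b1 - a" "b2 - a" "b3 - a" "b4 - a" z] by simp
  consider "b - a = 1" | "b - a = -1" using True by linarith
  then show ?thesis
  proof cases
    case 1
    have "(\<Sum>b'\<in>{a' - a - 1, a' - a + 1}. W (l + of_int a) 0 1 (a' - a) b' u * W (l + of_int a) 1 (c - a) b' (c' - a) v
          * W (l + of_int a) (a' - a) b' (b'' - a) (c' - a) w)
      = (\<Sum>b'\<in>{-1, 1}. W (l + of_int a) 0 1 b' (c - a) w * W (l + of_int a) 0 b' (a' - a) (b'' - a) v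
          * W (l + of_int a) b' (c - a) (b'' - a) (c' - a) u)"
      by (rule main) (use nz' 1 True in auto)
    then show ?thesis
      using 1 unfolding sh by (simp add: algebra_simps)
  next
    case 2
    define l' where "l' = - (l + of_int a)"
    have neg: "W (l + of_int a) b1 b2 b3 b4 z = W l' (- b1) (- b2) (- b3) (- b4) z" for b1 b2 b3 b4 z
      using W_neg[of "l + of_int a" "- b1" "- b2" "- b3" "- b4"] by (simp add: l'_def)
    have "B (l' + of_int k) \<noteq> 0" for k
      using nz'[of "- k"] B_minus[of "l + of_int a + of_int (- k)"] by (simp add: l'_def algebra_simps)
    then have "(\<Sum>b'\<in>{a - a' - 1, a - a' + 1}. W l' 0 1 (a - a') b' u * W l' 1 (a - c) b' (a - c') v
          * W l' (a - a') b' (a - b'') (a - c') w)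
      = (\<Sum>b'\<in>{-1, 1}. W l' 0 1 b' (a - c) w * W l' 0 b' (a - a') (a - b'') v
          * W l' b' (a - c) (a - b'') (a - c') u)"
      by (intro main) (use 2 True in auto)
    moreover have "a - b = 1" using 2 by simp
    ultimately show ?thesis
      unfolding sh neg by (simp add: algebra_simps)
  qed
qed

end

section \<open>Transfer sums along a column of heights\<close>

text \<open>Pinning the values beyond n makes a path determined by finitely many heights. The sets
  \<open>V i\<close> concern positions before n, as the endpoint is prescribed.\<close>

definition path_set :: "(nat \<Rightarrow> int set) \<Rightarrow> int \<Rightarrow> nat \<Rightarrow> int \<Rightarrow> (nat \<Rightarrow> int) set" where
  "path_set V b0 n bn = {b. b 0 = b0 \<and> b n = bn \<and> (\<forall>i<n. b i \<in> V i) \<and> (\<forall>i>n. b i = 0)}"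

text \<open>An entry of a product of transfer matrices \<open>T 0\<close>, \<open>T 1\<close>, and
  so on, where \<open>V i\<close> indexes the states at position i.\<close>

fun path_sum :: "(nat \<Rightarrow> int \<Rightarrow> int \<Rightarrow> 'a :: comm_ring_1) \<Rightarrow> (nat \<Rightarrow> int set) \<Rightarrow> int \<Rightarrow> nat \<Rightarrow> int \<Rightarrow> 'a" where
  "path_sum T V b0 0 b = of_bool (b = b0)"
| "path_sum T V b0 (Suc m) b' = (\<Sum>b\<in>V m. path_sum T V b0 m b * T m b b')"

lemma path_set_0: "path_set V b0 0 bn = (if bn = b0 then {(\<lambda>_. 0)(0 := b0)} else {})"
  by (auto simp: path_set_def fun_eq_iff)

lemma path_set_Suc:
  "path_set V b0 (Suc n) b' = (\<lambda>(c, b). b(Suc n := b')) ` (SIGMA c:V n. path_set V b0 n c)"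
proof (intro equalityI subsetI)
  fix b assume b: "b \<in> path_set V b0 (Suc n) b'"
  have "b = (b(Suc n := 0))(Suc n := b')" using b by (auto simp: path_set_def)
  moreover have "b(Suc n := 0) \<in> path_set V b0 n (b n)" "b n \<in> V n"
    using b by (auto simp: path_set_def)
  ultimately show "b \<in> (\<lambda>(c, b). b(Suc n := b')) ` (SIGMA c:V n. path_set V b0 n c)"
    by (intro image_eqI[of _ _ "(b n, b(Suc n := 0))"]) auto
qed (auto simp: path_set_def less_Suc_eq)

lemma finite_path_set: "(\<And>i. finite (V i)) \<Longrightarrow> finite (path_set V b0 n bn)"
  by (induction n arbitrary: bn) (auto simp: path_set_0 path_set_Suc)

lemma sum_path_set:
  assumes fin: "\<And>i. finite (V i)"
  shows "(\<Sum>b\<in>path_set V b0 n bn. \<Prod>i<n. T i (b i) (b (Suc i))) = path_sum T V b0 n bn"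
proof (induction n arbitrary: bn)
  case 0
  show ?case by (simp add: path_set_0)
next
  case (Suc n)
  have inj: "inj_on (\<lambda>(c, b). b(Suc n := bn)) (SIGMA c:V n. path_set V b0 n c)"
  proof (rule inj_onI, clarsimp)
    fix c b c' b' assume *: "b \<in> path_set V b0 n c" "b' \<in> path_set V b0 n c'" "b(Suc n := bn) = b'(Suc n := bn)"
    have "b i = b' i" for i
      using fun_cong[OF *(3), of i] *(1,2) by (cases "i = Suc n") (auto simp: path_set_def)
    then have "b = b'" by blast
    then show "c = c' \<and> b = b'" using *(1,2) by (auto simp: path_set_def)
  qed
  have "(\<Sum>b\<in>path_set V b0 (Suc n) bn. \<Prod>i<Suc n. T i (b i) (b (Suc i)))
    = (\<Sum>(c, b)\<in>(SIGMA c:V n. path_set V b0 n c). (\<Prod>i<n. T i (b i) (b (Suc i))) * T n c bn)"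
    unfolding path_set_Suc sum.reindex[OF inj]
    by (rule sum.cong) (auto simp: path_set_def intro!: prod.cong)
  also have "\<dots> = (\<Sum>c\<in>V n. (\<Sum>b\<in>path_set V b0 n c. \<Prod>i<n. T i (b i) (b (Suc i))) * T n c bn)"
    by (subst sum.Sigma[symmetric]) (auto simp: fin finite_path_set sum_distrib_right)
  also have "\<dots> = path_sum T V b0 (Suc n) bn" by (simp add: Suc.IH)
  finally show ?case .
qed

text \<open>If \<open>X\<close> intertwines the two families of transfer matrices and acts at both
  ends as the same nonzero scalar, it can be pulled through the whole product and cancelled.\<close>

lemma path_sum_intertwine:
  fixes T T' :: "nat \<Rightarrow> int \<Rightarrow> int \<Rightarrow> 'a :: idom"
  assumes fin: "\<And>i. finite (V i)" and b0: "b0 \<in> V 0" and bn: "bn \<in> V n"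
    and X: "\<And>m b b''. m < n \<Longrightarrow> (\<Sum>b'\<in>V (Suc m). T m b b' * X (Suc m) b' b'') = (\<Sum>b'\<in>V m. X m b b' * T' m b' b'')"
    and X0: "\<And>b. X 0 b0 b = \<xi> * of_bool (b = b0)"
    and Xn: "\<And>b. X n b bn = \<xi> * of_bool (b = bn)" and xi: "\<xi> \<noteq> 0"
  shows "path_sum T V b0 n bn = path_sum T' V b0 n bn"
proof -
  \<comment> \<open>An \<open>X\<close> inserted at position m is moved back to position 0, turning
    each \<open>T\<close> that it passes into \<open>T'\<close>; there it acts as \<xi>.\<close>
  have "(\<Sum>b\<in>V m. path_sum T V b0 m b * X m b b'') = \<xi> * path_sum T' V b0 m b''" if "m \<le> n" for m b''
    using that
  proof (induction m arbitrary: b'')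
    case 0
    show ?case using fin b0 X0 by (simp add: of_bool_def if_distrib[of "\<lambda>z. z * _"] cong: if_cong)
  next
    case (Suc m)
    have "(\<Sum>b'\<in>V (Suc m). path_sum T V b0 (Suc m) b' * X (Suc m) b' b'')
      = (\<Sum>b\<in>V m. path_sum T V b0 m b * (\<Sum>b'\<in>V (Suc m). T m b b' * X (Suc m) b' b''))"
      by (simp add: sum_distrib_left sum_distrib_right mult.assoc sum.swap[of _ "V (Suc m)"])
    also have "\<dots> = (\<Sum>b\<in>V m. path_sum T V b0 m b * (\<Sum>b'\<in>V m. X m b b' * T' m b' b''))"
      using X Suc.prems by simp
    also have "\<dots> = (\<Sum>b'\<in>V m. (\<Sum>b\<in>V m. path_sum T V b0 m b * X m b b') * T' m b' b'')"
      by (simp only: sum_distrib_left sum_distrib_right mult.assoc) (rule sum.swap)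
    also have "\<dots> = \<xi> * path_sum T' V b0 (Suc m) b''"
      using Suc by (simp add: sum_distrib_left mult.assoc)
    finally show ?case .
  qed
  from this[of n bn] have "(\<Sum>b\<in>V n. path_sum T V b0 n b * X n b bn) = \<xi> * path_sum T' V b0 n bn" by simp
  moreover have "(\<Sum>b\<in>V n. path_sum T V b0 n b * X n b bn) = path_sum T V b0 n bn * \<xi>"
    using fin bn Xn by (simp add: of_bool_def if_distrib[of "\<lambda>z. _ * z"] cong: if_cong)
  ultimately show ?thesis using xi by simp
qed

section \<open>Symmetry of the partition function\<close>


text \<open>Total functions allow a column or border to be changed by pointwise redefinition. The
  value 0 outside the square makes the correspondence with \<open>states\<close> bijective.\<close>

definition height_functions :: "nat \<Rightarrow> (nat \<Rightarrow> nat \<Rightarrow> int) set" where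
  "height_functions n = {A. (\<forall>i j. i > n \<or> j > n \<longrightarrow> A i j = 0) \<and>
     (\<forall>i\<le>n. \<forall>j<n. \<bar>A i (Suc j) - A i j\<bar> = 1) \<and>
     (\<forall>i<n. \<forall>j\<le>n. \<bar>A (Suc i) j - A i j\<bar> = 1) \<and>
     (\<forall>k\<le>n. A 0 k = int k \<and> A k 0 = int k \<and> A n k = int (n - k) \<and> A k n = int (n - k))}"

lemma bij_betw_states:
  "bij_betw (\<lambda>M i j. if i \<le> n \<and> j \<le> n then M $$ (i, j) else 0) (states n) (height_functions n)"
proof (rule bij_betw_byWitness[where f' = "\<lambda>A. Matrix.mat (n + 1) (n + 1) (\<lambda>(i, j). A i j)"])
  show "\<forall>M\<in>states n. Matrix.mat (n + 1) (n + 1) (\<lambda>(i, j). if i \<le> n \<and> j \<le> n then M $$ (i, j) else 0) = M"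
    by (auto simp: states_def intro!: eq_matI)
  show "\<forall>A\<in>height_functions n. (\<lambda>i j. if i \<le> n \<and> j \<le> n then Matrix.mat (n + 1) (n + 1) (\<lambda>(i, j). A i j) $$ (i, j) else 0) = A"
    by (auto simp: height_functions_def fun_eq_iff)
  show "(\<lambda>M i j. if i \<le> n \<and> j \<le> n then M $$ (i, j) else 0) ` states n \<subseteq> height_functions n"
    by (auto simp: states_def height_functions_def)
  show "(\<lambda>A. Matrix.mat (n + 1) (n + 1) (\<lambda>(i, j). A i j)) ` height_functions n \<subseteq> states n"
    by (auto simp: states_def height_functions_def)
qed

lemma finite_height_functions: "finite (height_functions n)"
  using bij_betw_states finite_states bij_betw_finite by blast

lemma height_functions_0: "height_functions 0 = {\<lambda>_ _. 0}"
  by (auto simp: height_functions_def fun_eq_iff) (metis gr0I)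

lemma height_functionsD:
  assumes "A \<in> height_functions n"
  shows "i \<le> n \<Longrightarrow> j < n \<Longrightarrow> \<bar>A i (Suc j) - A i j\<bar> = 1"
    and "i < n \<Longrightarrow> j \<le> n \<Longrightarrow> \<bar>A (Suc i) j - A i j\<bar> = 1"
    and "k \<le> n \<Longrightarrow> A 0 k = int k" "k \<le> n \<Longrightarrow> A k 0 = int k"
    and "k \<le> n \<Longrightarrow> A n k = int (n - k)" "k \<le> n \<Longrightarrow> A k n = int (n - k)"
    and "i > n \<or> j > n \<Longrightarrow> A i j = 0"
  using assms unfolding height_functions_def by blast+

lemma unit_steps_lipschitz:
  fixes f :: "nat \<Rightarrow> int"
  assumes "\<And>j. j < n \<Longrightarrow> \<bar>f (Suc j) - f j\<bar> = 1" "i \<le> n" "j \<le> n"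
  shows "\<bar>f i - f j\<bar> \<le> \<bar>int i - int j\<bar>"
proof -
  have "\<bar>f (i + k) - f i\<bar> \<le> int k" if "i + k \<le> n" for i k
    using that
  proof (induction k)
    case (Suc k)
    then show ?case using assms(1)[of "i + k"] by fastforce
  qed simp
  from this[of i "j - i"] this[of j "i - j"] assms(2,3) show ?thesis
    by (cases "i \<le> j") (auto simp: of_nat_diff)
qed

text \<open>Used for rigidity: heights at two places that attain the bound force everything between
  them.\<close>

lemma height_lipschitz:
  assumes "A \<in> height_functions n" "i \<le> n" "j \<le> n" "k \<le> n"
  shows "\<bar>A i j - A i k\<bar> \<le> \<bar>int j - int k\<bar>" "\<bar>A j i - A k i\<bar> \<le> \<bar>int j - int k\<bar>"
  using unit_steps_lipschitz[of n "A i" j k] unit_steps_lipschitz[of n "\<lambda>j. A j i" j k]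
    height_functionsD(1,2)[OF assms(1)] assms(2-) by auto

text \<open>It bounds the possible denominators of the partition function to [\<lambda>],
  [\<lambda> + 1], ..., [\<lambda> + n].\<close>

lemma height_bounds:
  assumes A: "A \<in> height_functions n" and "i \<le> n" "j \<le> n"
  shows "A i j \<ge> 0" "A i j \<le> int n"
  using height_lipschitz(1)[OF A \<open>i \<le> n\<close> \<open>j \<le> n\<close>, of 0] height_lipschitz(1)[OF A \<open>i \<le> n\<close> \<open>j \<le> n\<close>, of n]
    height_lipschitz(2)[OF A \<open>j \<le> n\<close> \<open>i \<le> n\<close>, of 0] height_functionsD(3,4,6)[OF A] assms(2,3)
  by (auto simp: of_nat_diff)

context theta
begin

definition Zh :: "nat \<Rightarrow> (nat \<Rightarrow> complex) \<Rightarrow> (nat \<Rightarrow> complex) \<Rightarrow> complex \<Rightarrow> complex" where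
  "Zh n X Y l = (\<Sum>A\<in>height_functions n. \<Prod>i<n. \<Prod>j<n.
     W l (A i j) (A i (Suc j)) (A (Suc i) j) (A (Suc i) (Suc j)) (X i - Y j))"

lemma Z_eq_Zh: "Z \<tau> \<eta> n x y l = Zh n (\<lambda>i. x (Suc i)) (\<lambda>j. y (Suc j)) l"
proof -
  have "Z \<tau> \<eta> n x y l = (\<Sum>A\<in>states n. \<Prod>i<n. \<Prod>j<n. block_weight \<tau> \<eta> x y l A (Suc i) (Suc j))"
    unfolding Z_def by (simp add: prod.atLeast1_atMost_eq)
  also have "\<dots> = Zh n (\<lambda>i. x (Suc i)) (\<lambda>j. y (Suc j)) l"
    unfolding Zh_def
    by (subst sum.reindex_bij_betw[OF bij_betw_states, symmetric])
      (auto intro!: sum.cong prod.cong simp: block_weight_def W_def Let_def)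
  finally show ?thesis .
qed

lemma Zh_cong:
  "(\<And>i. i < n \<Longrightarrow> X i = X' i) \<Longrightarrow> (\<And>i. i < n \<Longrightarrow> Y i = Y' i) \<Longrightarrow> Zh n X Y l = Zh n X' Y' l"
  unfolding Zh_def by (intro sum.cong prod.cong) auto

text \<open>An R-matrix with parameter \<open>y\<^sub>j\<^sub>+\<^sub>1 - y\<^sub>j\<close> is pulled through the two columns from top to bottom;
  at both ends the boundary heights are monotone, so it contributes the same scalar.\<close>

lemma Zh_swap_adjacent:
  assumes nz: "\<And>k :: int. B (l + of_int k) \<noteq> 0" and j: "Suc j < n" and r: "B (Y (Suc j) - Y j + 1) \<noteq> 0"
  shows "Zh n X (Y(j := Y (Suc j), Suc j := Y j)) l = Zh n X Y l"
proof -
  let ?k = "Suc j"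
  \<comment> \<open>Height column \<open>?k\<close> borders exactly the block columns
    \<open>j\<close> and \<open>?k\<close>. States are therefore grouped by their other heights, and
    in each group only column \<open>?k\<close> varies.\<close>
  define erase where "erase = (\<lambda>A :: nat \<Rightarrow> nat \<Rightarrow> int. \<lambda>i. (A i)(?k := 0))"
  define ins where "ins = (\<lambda>(C :: nat \<Rightarrow> nat \<Rightarrow> int) b. \<lambda>i. (C i)(?k := b i))"
  define wt where "wt Y A = (\<Prod>i<n. \<Prod>j<n.
     W l (A i j) (A i (Suc j)) (A (Suc i) j) (A (Suc i) (Suc j)) (X i - Y j))" for Y A
  define R where "R C = (\<Prod>i<n. \<Prod>m\<in>{..<n} - {j, ?k}.
     W l (C i m) (C i (Suc m)) (C (Suc i) m) (C (Suc i) (Suc m)) (X i - Y m))" for C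
  define T where "T C y y' = (\<lambda>m b b'. W l (C m j) b (C (Suc m) j) b' (X m - y)
     * W l b (C m (Suc ?k)) b' (C (Suc m) (Suc ?k)) (X m - y'))" for C :: "nat \<Rightarrow> nat \<Rightarrow> int" and y y'
  let ?Y = "Y(j := Y ?k, ?k := Y j)"
  have wt: "wt Y' (ins C b) = R C * (\<Prod>i<n. T C (Y' j) (Y' ?k) i (b i) (b (Suc i)))"
    if "\<And>m. m \<noteq> j \<Longrightarrow> m \<noteq> ?k \<Longrightarrow> Y' m = Y m" for Y' C b
  proof -
    have "(\<Prod>m<n. W l (ins C b i m) (ins C b i (Suc m)) (ins C b (Suc i) m) (ins C b (Suc i) (Suc m)) (X i - Y' m))
      = (\<Prod>m\<in>{..<n} - {j, ?k}. W l (C i m) (C i (Suc m)) (C (Suc i) m) (C (Suc i) (Suc m)) (X i - Y m))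
        * T C (Y' j) (Y' ?k) i (b i) (b (Suc i))" for i
    proof -
      have "(\<Prod>m<n. W l (ins C b i m) (ins C b i (Suc m)) (ins C b (Suc i) m) (ins C b (Suc i) (Suc m)) (X i - Y' m))
        = (\<Prod>m\<in>{..<n} - {j, ?k}. W l (ins C b i m) (ins C b i (Suc m)) (ins C b (Suc i) m) (ins C b (Suc i) (Suc m)) (X i - Y' m))
          * (\<Prod>m\<in>{j, ?k}. W l (ins C b i m) (ins C b i (Suc m)) (ins C b (Suc i) m) (ins C b (Suc i) (Suc m)) (X i - Y' m))"
        using j by (intro prod.subset_diff) auto
      also have "(\<Prod>m\<in>{..<n} - {j, ?k}. W l (ins C b i m) (ins C b i (Suc m)) (ins C b (Suc i) m) (ins C b (Suc i) (Suc m)) (X i - Y' m))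
         = (\<Prod>m\<in>{..<n} - {j, ?k}. W l (C i m) (C i (Suc m)) (C (Suc i) m) (C (Suc i) (Suc m)) (X i - Y m))"
        using that by (intro prod.cong) (auto simp: ins_def)
      finally show ?thesis by (simp add: T_def ins_def)
    qed
    then show ?thesis by (simp add: wt_def R_def prod.distrib)
  qed
  have fiber: "(\<Sum>A\<in>{A \<in> height_functions n. erase A = C}. wt ?Y A) = (\<Sum>A\<in>{A \<in> height_functions n. erase A = C}. wt Y A)"
    if C: "C \<in> erase ` height_functions n" for C
  proof -
    obtain A0 where A0: "A0 \<in> height_functions n" "C = erase A0" using C by blast
    have CA: "C i m = A0 i m" if "m \<noteq> ?k" for i m using A0(2) that by (simp add: erase_def)
    have Ck: "C i ?k = 0" for i using A0(2) by (simp add: erase_def)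
    \<comment> \<open>This records adjacency to the left neighbour only; paths that violate another
      adjacency condition have weight 0.\<close>
    define V where "V m = {C m j - 1, C m j + 1}" for m
    define b0 where "b0 = int ?k"
    define bn where "bn = int (n - ?k)"
    let ?P = "path_set V b0 n bn"
    have fin: "finite (V m)" for m by (simp add: V_def)
    have bd: "C 0 j = int j" "C 0 (Suc ?k) = int (Suc ?k)" "C n j = int (n - j)" "C n (Suc ?k) = int (n - Suc ?k)"
      using A0 j by (auto simp: height_functions_def erase_def)
    have H: "ins C b \<in> height_functions n \<longleftrightarrow> (\<forall>i<n. \<bar>b (Suc i) - b i\<bar> = 1) \<and>
       (\<forall>i\<le>n. \<bar>b i - C i j\<bar> = 1 \<and> \<bar>C i (Suc ?k) - b i\<bar> = 1) \<and> b 0 = b0 \<and> b n = bn \<and> (\<forall>i>n. b i = 0)" for b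
    proof
      assume I: "ins C b \<in> height_functions n"
      have "\<bar>b (Suc i) - b i\<bar> = 1" if "i < n" for i
        using height_functionsD(2)[OF I that, of ?k] j by (simp add: ins_def)
      moreover have "\<bar>b i - C i j\<bar> = 1" "\<bar>C i (Suc ?k) - b i\<bar> = 1" if "i \<le> n" for i
        using height_functionsD(1)[OF I that, of j] height_functionsD(1)[OF I that, of ?k] j
        by (auto simp: ins_def)
      moreover have "b 0 = b0" "b n = bn"
        using height_functionsD(3,5)[OF I, of ?k] j by (auto simp: ins_def b0_def bn_def)
      moreover have "\<forall>i>n. b i = 0"
        using height_functionsD(7)[OF I, of _ ?k] by (auto simp: ins_def)
      ultimately show "(\<forall>i<n. \<bar>b (Suc i) - b i\<bar> = 1) \<and>
       (\<forall>i\<le>n. \<bar>b i - C i j\<bar> = 1 \<and> \<bar>C i (Suc ?k) - b i\<bar> = 1) \<and> b 0 = b0 \<and> b n = bn \<and> (\<forall>i>n. b i = 0)" by blast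
    next
      assume I: "(\<forall>i<n. \<bar>b (Suc i) - b i\<bar> = 1) \<and>
       (\<forall>i\<le>n. \<bar>b i - C i j\<bar> = 1 \<and> \<bar>C i (Suc ?k) - b i\<bar> = 1) \<and> b 0 = b0 \<and> b n = bn \<and> (\<forall>i>n. b i = 0)"
      have "\<bar>ins C b i (Suc m) - ins C b i m\<bar> = 1" if "i \<le> n" "m < n" for i m
      proof -
        consider "m = j" | "m = ?k" | "m \<noteq> j" "m \<noteq> ?k" by blast
        then show ?thesis
        proof cases
          case 3
          then show ?thesis using A0(1) that by (simp add: ins_def CA height_functions_def)
        qed (use I that in \<open>auto simp: ins_def\<close>)
      qed
      moreover have "\<bar>ins C b (Suc i) m - ins C b i m\<bar> = 1" if "i < n" "m \<le> n" for i m
        using that I A0(1) by (cases "m = ?k") (auto simp: ins_def CA height_functions_def)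
      moreover have "ins C b i m = 0" if "i > n \<or> m > n" for i m
        using that I A0(1) j by (cases "m = ?k") (auto simp: ins_def CA height_functions_def)
      moreover have "ins C b 0 m = int m \<and> ins C b m 0 = int m \<and> ins C b n m = int (n - m) \<and> ins C b m n = int (n - m)" if "m \<le> n" for m
        using that I A0(1) j by (cases "m = ?k") (auto simp: ins_def CA height_functions_def b0_def bn_def)
      ultimately show "ins C b \<in> height_functions n" unfolding height_functions_def by blast
    qed
    have ab: "x \<in> {y - 1, y + 1}" if "\<bar>x - y\<bar> = 1" for x y :: int
      using that by auto
    have fib: "{A \<in> height_functions n. erase A = C} = ins C ` {b \<in> ?P. ins C b \<in> height_functions n}"
    proof (intro equalityI subsetI)
      fix A assume A: "A \<in> {A \<in> height_functions n. erase A = C}"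
      then have CeA: "C = erase A" by simp
      have "A = ins C (\<lambda>i. A i ?k)" unfolding CeA by (auto simp: fun_eq_iff ins_def erase_def)
      moreover from this have "ins C (\<lambda>i. A i ?k) \<in> height_functions n" using A by simp
      moreover from this have "(\<lambda>i. A i ?k) \<in> ?P" unfolding H path_set_def V_def
        using ab less_imp_le by blast
      ultimately show "A \<in> ins C ` {b \<in> ?P. ins C b \<in> height_functions n}" by blast
    next
      fix A assume "A \<in> ins C ` {b \<in> ?P. ins C b \<in> height_functions n}"
      then show "A \<in> {A \<in> height_functions n. erase A = C}"
        by (auto simp: fun_eq_iff ins_def erase_def Ck)
    qed
    have inj: "inj_on (ins C) S" for S
      by (rule inj_onI) (metis (no_types, lifting) fun_upd_same ins_def ext)
    have n0: "n > 0" using j by simp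
    have sum_fib: "(\<Sum>A\<in>{A \<in> height_functions n. erase A = C}. wt Y' A) = R C * path_sum (T C (Y' j) (Y' ?k)) V b0 n bn"
      if Y': "\<And>m. m \<noteq> j \<Longrightarrow> m \<noteq> ?k \<Longrightarrow> Y' m = Y m" for Y'
    proof -
      have "(\<Sum>A\<in>{A \<in> height_functions n. erase A = C}. wt Y' A)
        = (\<Sum>b\<in>{b \<in> ?P. ins C b \<in> height_functions n}. R C * (\<Prod>i<n. T C (Y' j) (Y' ?k) i (b i) (b (Suc i))))"
        unfolding fib sum.reindex[OF inj] by (simp add: wt[OF Y'])
      also have "\<dots> = (\<Sum>b\<in>?P. R C * (\<Prod>i<n. T C (Y' j) (Y' ?k) i (b i) (b (Suc i))))"
      proof (rule sum.mono_neutral_left)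
        show "\<forall>b\<in>?P - {b \<in> ?P. ins C b \<in> height_functions n}. R C * (\<Prod>i<n. T C (Y' j) (Y' ?k) i (b i) (b (Suc i))) = 0"
        proof (rule ballI, rule ccontr)
          fix b assume b: "b \<in> ?P - {b \<in> ?P. ins C b \<in> height_functions n}"
            and "R C * (\<Prod>i<n. T C (Y' j) (Y' ?k) i (b i) (b (Suc i))) \<noteq> 0"
          then have "T C (Y' j) (Y' ?k) i (b i) (b (Suc i)) \<noteq> 0" if "i < n" for i
            using that by auto
          then have W: "W l (C i j) (b i) (C (Suc i) j) (b (Suc i)) (X i - Y' j) \<noteq> 0"
            "W l (b i) (C i (Suc ?k)) (b (Suc i)) (C (Suc i) (Suc ?k)) (X i - Y' ?k) \<noteq> 0" if "i < n" for i
            using that unfolding T_def by auto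
          have "\<bar>b (Suc i) - b i\<bar> = 1" if "i < n" for i
            using W_nonzero_adjacent(2)[OF W(1)[OF that]] .
          moreover have "\<bar>b i - C i j\<bar> = 1" "\<bar>C i (Suc ?k) - b i\<bar> = 1" if "i \<le> n" for i
          proof -
            consider "i < n" | i' where "i = Suc i'" "i' < n" using \<open>i \<le> n\<close> n0 by (metis Suc_pred le_neq_implies_less lessI)
            then show "\<bar>b i - C i j\<bar> = 1" "\<bar>C i (Suc ?k) - b i\<bar> = 1"
              using W_nonzero_adjacent(1,3)[OF W(1)] W_nonzero_adjacent(1,3)[OF W(2)] by (cases; blast)+
          qed
          ultimately have "ins C b \<in> height_functions n" unfolding H using b by (auto simp: path_set_def)
          then show False using b by blast
        qed
      qed (auto simp: finite_path_set fin)
      also have "\<dots> = R C * path_sum (T C (Y' j) (Y' ?k)) V b0 n bn"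
        by (simp only: sum_distrib_left[symmetric] sum_path_set[where T = "T C (Y' j) (Y' ?k)", OF fin])
      finally show ?thesis .
    qed
    define w where "w = Y ?k - Y j"
    have "path_sum (T C (Y j) (Y ?k)) V b0 n bn = path_sum (T C (Y ?k) (Y j)) V b0 n bn"
    proof (rule path_sum_intertwine[where X = "\<lambda>m b b''. W l (C m j) b b'' (C m (Suc ?k)) w"])
      show "finite (V i)" for i by (rule fin)
      show "b0 \<in> V 0" "bn \<in> V n" using j bd by (auto simp: V_def b0_def bn_def)
      \<comment> \<open>Cancelling this scalar is where hypothesis \<open>r\<close> enters.\<close>
      show "B (w + 1) / B 1 \<noteq> 0" using r B_1 by (simp add: w_def)
      show "W l (C 0 j) b0 b (C 0 (Suc ?k)) w = B (w + 1) / B 1 * of_bool (b = b0)" for b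
        by (auto simp: bd b0_def W_def Rmat_def)
      show "W l (C n j) b bn (C n (Suc ?k)) w = B (w + 1) / B 1 * of_bool (b = bn)" for b
        using j by (auto simp: bd bn_def W_def Rmat_def of_nat_diff)
      show "(\<Sum>b'\<in>V (Suc m). T C (Y j) (Y ?k) m b b' * W l (C (Suc m) j) b' b'' (C (Suc m) (Suc ?k)) w)
        = (\<Sum>b'\<in>V m. W l (C m j) b b' (C m (Suc ?k)) w * T C (Y ?k) (Y j) m b' b'')" for m b b''
        using yang_baxter[OF nz, where u = "X m - Y j" and v = "X m - Y ?k" and w = w and a = "C m j" and b = b
            and c = "C m (Suc ?k)" and c' = "C (Suc m) (Suc ?k)" and b'' = b'' and a' = "C (Suc m) j"]
        by (simp add: V_def T_def w_def mult.assoc)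
    qed
    then show ?thesis using sum_fib[of ?Y] sum_fib[of Y] by simp
  qed
  have "(\<Sum>A\<in>height_functions n. wt ?Y A) = (\<Sum>A\<in>height_functions n. wt Y A)"
    unfolding sum.image_gen[OF finite_height_functions, of _ _ erase]
    using fiber by (rule sum.cong[OF refl])
  then show ?thesis unfolding Zh_def wt_def .
qed

end

section \<open>Frozen corners\<close>


text \<open>Along a frozen border the dynamical factors are quotients at consecutive descending
  heights.\<close>

lemma prod_telescope_down:
  fixes g :: "nat \<Rightarrow> 'a :: field"
  assumes "\<And>k. g k \<noteq> 0"
  shows "(\<Prod>i<m. g (Suc (m - i)) / g (m - i)) = g (Suc m) / g 1"
    and "(\<Prod>i<m. g (m - Suc i) / g (m - i)) = g 0 / g m"
proof -
  show "(\<Prod>i<m. g (Suc (m - i)) / g (m - i)) = g (Suc m) / g 1"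
    by (induction m) (simp_all add: assms prod.lessThan_Suc_shift del: prod.lessThan_Suc)
  show "(\<Prod>i<m. g (m - Suc i) / g (m - i)) = g 0 / g m"
    by (induction m) (simp_all add: assms prod.lessThan_Suc_shift del: prod.lessThan_Suc)
qed

lemma prod_border_last:
  fixes f :: "nat \<Rightarrow> nat \<Rightarrow> 'a :: comm_monoid_mult"
  shows "(\<Prod>i<Suc m. \<Prod>j<Suc m. f i j) = (\<Prod>i<m. f i m) * (\<Prod>j<m. f m j) * f m m * (\<Prod>i<m. \<Prod>j<m. f i j)"
  by (simp add: prod.distrib mult_ac)

lemma prod_border_first_column:
  fixes f :: "nat \<Rightarrow> nat \<Rightarrow> 'a :: comm_monoid_mult"
  shows "(\<Prod>i<Suc m. \<Prod>j<Suc m. f i j)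
    = (\<Prod>i<m. f i 0) * (\<Prod>j<m. f m (Suc j)) * f m 0 * (\<Prod>i<m. \<Prod>j<m. f i (Suc j))"
  by (simp add: prod.lessThan_Suc_shift[where n = m and g = "f _"] prod.distrib mult_ac del: prod.lessThan_Suc)
     (simp add: prod.lessThan_Suc mult_ac)

context theta
begin

text \<open>Only the last row of blocks involves z. Its upper heights lie below the lower ones up to
  one switching block and above them afterwards. Blocks before the switch contribute [u], blocks
  after it [u + 1], the switch itself [\<lambda> + a - u]. Moving the switch to the right lowers a
  by as much as it reduces the number of shifts by 1, so all states have the same
  multipliers.\<close>

lemma theta_fun_Zh_last_row:
  "theta_fun (Suc m) ((\<Sum>j<Suc m. Y j) + l) (\<lambda>z. Zh (Suc m) (X(m := z)) Y l)"
proof -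
  let ?n = "Suc m"
  \<comment> \<open>The conditional term is what the switch has contributed so far, reduced by 1 for
    each later block; after all \<open>?n\<close> blocks it equals \<open>l\<close>.\<close>
  have row: "theta_fun k ((\<Sum>j<k. Y j) + (if A m k = int (?n - k) + 1 then l + of_int (int (?n - k)) else 0))
      (\<lambda>z. \<Prod>j<k. W l (A m j) (A m (Suc j)) (A ?n j) (A ?n (Suc j)) (z - Y j))"
    if A: "A \<in> height_functions ?n" and "k \<le> ?n" for A k
    using \<open>k \<le> ?n\<close>
  proof (induction k)
    case 0
    have "A m 0 = int m" using height_functionsD(4)[OF A, of m] by simp
    then show ?case using theta_fun_const[of 1] by simp
  next
    case (Suc k)
    define N where "N = int (?n - k)"
    have N: "int (?n - Suc k) = N - 1" using Suc.prems by (simp add: N_def)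
    have cd: "A ?n k = N" "A ?n (Suc k) = N - 1"
      using height_functionsD(5)[OF A, of k] height_functionsD(5)[OF A, of "Suc k"] Suc.prems N by (simp_all add: N_def)
    have "\<bar>A m (Suc k) - A m k\<bar> = 1" "\<bar>A ?n k - A m k\<bar> = 1" "\<bar>A ?n (Suc k) - A m (Suc k)\<bar> = 1"
      using height_functionsD(1)[OF A, of m k] height_functionsD(2)[OF A, of m k] height_functionsD(2)[OF A, of m "Suc k"] Suc.prems by auto
    then consider "A m k = N + 1" "A m (Suc k) = N" | "A m k = N - 1" "A m (Suc k) = N" | "A m k = N - 1" "A m (Suc k) = N - 2"
      unfolding cd by linarith
    note ab = this
    have IH: "theta_fun k ((\<Sum>j<k. Y j) + (if A m k = N + 1 then l + of_int N else 0))
      (\<lambda>z. \<Prod>j<k. W l (A m j) (A m (Suc j)) (A ?n j) (A ?n (Suc j)) (z - Y j))"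
      using Suc unfolding N_def by simp
    have step: "theta_fun 1 (Y k + (if A m (Suc k) = N then l + of_int (N - 1) else 0) - (if A m k = N + 1 then l + of_int N else 0))
      (\<lambda>z. W l (A m k) (A m (Suc k)) (A ?n k) (A ?n (Suc k)) (z - Y k))"
      using ab
    proof cases
      case 1
      have "theta_fun 1 (Y k - 1) (\<lambda>z. (1 / B 1) * B (z + 1 - Y k))" by (intro theta_fun_cmult theta_fun_B_shift)
      then show ?thesis by (simp add: 1 cd W_def Rmat_def algebra_simps)
    next
      case 2
      have "theta_fun 1 (Y k + l + of_int (N - 1)) (\<lambda>z. (1 / B (l + of_int (N - 1))) * B (Y k + l + of_int (N - 1) - z))"
        by (intro theta_fun_cmult theta_fun_B_neg)
      then show ?thesis by (simp add: 2 cd W_def Rmat_def algebra_simps)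
    next
      case 3
      have "theta_fun 1 (Y k) (\<lambda>z. (B (l + of_int (N - 1) - 1) / (B 1 * B (l + of_int (N - 1)))) * B (z - Y k))"
        by (intro theta_fun_cmult theta_fun_B)
      then show ?thesis by (simp add: 3 cd W_def Rmat_def mult_ac)
    qed
    have "(\<Sum>j<k. Y j) + (if A m k = N + 1 then l + of_int N else 0) + (Y k + (if A m (Suc k) = N then l + of_int (N - 1) else 0)
      - (if A m k = N + 1 then l + of_int N else 0)) = (\<Sum>j<Suc k. Y j) + (if A m (Suc k) = N then l + of_int (N - 1) else 0)"
      by simp
    with theta_fun_mult[OF IH step] show ?case unfolding N by simp
  qed
  have "theta_fun ?n ((\<Sum>j<?n. Y j) + l) (\<lambda>z. (\<Prod>i<m. \<Prod>j<?n. W l (A i j) (A i (Suc j)) (A (Suc i) j) (A (Suc i) (Suc j)) (X i - Y j))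
      * (\<Prod>j<?n. W l (A m j) (A m (Suc j)) (A ?n j) (A ?n (Suc j)) (z - Y j)))"
    if A: "A \<in> height_functions ?n" for A
  proof -
    have "A m ?n = 1" using height_functionsD(6)[OF A, of m] by simp
    then show ?thesis using theta_fun_cmult[OF row[OF A le_refl]] by simp
  qed
  moreover have "Zh ?n (X(m := z)) Y l = (\<Sum>A\<in>height_functions ?n.
      (\<Prod>i<m. \<Prod>j<?n. W l (A i j) (A i (Suc j)) (A (Suc i) j) (A (Suc i) (Suc j)) (X i - Y j))
      * (\<Prod>j<?n. W l (A m j) (A m (Suc j)) (A ?n j) (A ?n (Suc j)) (z - Y j)))" for z
    unfolding Zh_def prod.lessThan_Suc[of _ m, where g = "\<lambda>i. prod _ _"]
    by (intro sum.cong arg_cong2[where f = "(*)"] prod.cong refl) auto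
  ultimately show ?thesis by (simp add: theta_fun_sum)
qed

text \<open>The lower right block has u = -1, so [u + 1] kills the states with
  \<open>A m m = 2\<close>. The value 0 fixes row m and column m, and what remains inside the outer
  border is a state of size m. The dynamical factors of the border telescope to [\<lambda> + m + 1]
  / [\<lambda> + m].\<close>

lemma Zh_freeze_last:
  assumes nz: "\<And>k :: int. B (l + of_int k) \<noteq> 0" and x: "X m = Y m - 1"
  shows "Zh (Suc m) X Y l = B (l + of_nat (Suc m)) / B (l + of_nat m)
    * (\<Prod>i<m. B (X i - Y m) / B 1) * (\<Prod>k<m. B (X m - Y k) / B 1) * Zh m X Y l"
proof -
  let ?n = "Suc m"
  let ?f = "\<lambda>A i j. W l (A i j) (A i (Suc j)) (A (Suc i) j) (A (Suc i) (Suc j)) (X i - Y j)"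
  \<comment> \<open>\<open>E\<close> attaches the forced border and \<open>F\<close> cuts it
    off.\<close>
  define E where "E A = (\<lambda>i j. if i \<le> m \<and> j \<le> m then A i j else if i = ?n \<and> j \<le> ?n then int (?n - j)
    else if j = ?n \<and> i \<le> ?n then int (?n - i) else 0)" for A :: "nat \<Rightarrow> nat \<Rightarrow> int"
  define F where "F A = (\<lambda>i j. if i \<le> m \<and> j \<le> m then A i j else 0)" for A :: "nat \<Rightarrow> nat \<Rightarrow> int"
  have zero: "(\<Prod>i<?n. \<Prod>j<?n. ?f A i j) = 0" if A: "A \<in> height_functions ?n" and "A m m \<noteq> 0" for A
  proof -
    have "A ?n ?n = 0" "A m ?n = 1" "A ?n m = 1"
      using height_functionsD(5)[OF A, of ?n] height_functionsD(6)[OF A, of m] height_functionsD(5)[OF A, of m] by simp_all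
    moreover have "\<bar>A m ?n - A m m\<bar> = 1" using height_functionsD(1)[OF A, of m m] by simp
    then have "A m m = 2" using \<open>A m m \<noteq> 0\<close> \<open>A m ?n = 1\<close> by linarith
    ultimately have "?f A m m = 0" using x by (simp add: W_def Rmat_def)
    then show ?thesis by (simp add: prod_border_last)
  qed
  have weight: "(\<Prod>i<?n. \<Prod>j<?n. ?f (E A) i j) = B (l + of_nat (Suc m)) / B (l + of_nat m)
    * (\<Prod>i<m. B (X i - Y m) / B 1) * (\<Prod>k<m. B (X m - Y k) / B 1) * (\<Prod>i<m. \<Prod>j<m. ?f A i j)"
    if A: "A \<in> height_functions m" for A
  proof -
    define g where "g k = B (l + of_nat k)" for k
    have g: "g k \<noteq> 0" for k using nz[of "int k"] by (simp add: g_def)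
    have 1: "?f (E A) i m = (B (X i - Y m) / B 1) * (g (Suc (m - i)) / g (m - i))" if "i < m" for i
    proof -
      define r where "r = int (m - i)"
      have "A i m = r" "A (Suc i) m = r - 1"
        using that height_functionsD(6)[OF A, of i] height_functionsD(6)[OF A, of "Suc i"] by (simp_all add: r_def)
      moreover have "int (?n - i) = r + 1" "int (?n - Suc i) = r" "of_nat (m - i) = (of_int r :: complex)"
        using that by (simp_all add: r_def)
      ultimately show ?thesis
        using that by (simp add: E_def g_def W_def Rmat_def add_ac)
    qed
    have 2: "?f (E A) m j = (B (X m - Y j) / B 1) * (g (m - Suc j) / g (m - j))" if "j < m" for j
    proof -
      define r where "r = int (m - j)"
      have "A m j = r" "A m (Suc j) = r - 1"
        using that height_functionsD(5)[OF A, of j] height_functionsD(5)[OF A, of "Suc j"] by (simp_all add: r_def)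
      moreover have "int (?n - j) = r + 1" "int (?n - Suc j) = r" "g (m - j) = B (l + of_int r)" "g (m - Suc j) = B (l + of_int r - 1)"
        using that by (simp_all add: r_def g_def of_nat_diff algebra_simps)
      ultimately show ?thesis
        using that by (simp add: E_def W_def Rmat_def)
    qed
    have 3: "?f (E A) m m = g 1 / g 0"
      using height_functionsD(5)[OF A, of m] x by (simp add: E_def g_def W_def Rmat_def)
    have 4: "?f (E A) i j = ?f A i j" if "i < m" "j < m" for i j
      using that by (simp add: E_def)
    have "(\<Prod>i<?n. \<Prod>j<?n. ?f (E A) i j) = (\<Prod>i<m. (B (X i - Y m) / B 1) * (g (Suc (m - i)) / g (m - i)))
       * (\<Prod>j<m. (B (X m - Y j) / B 1) * (g (m - Suc j) / g (m - j))) * (g 1 / g 0) * (\<Prod>i<m. \<Prod>j<m. ?f A i j)"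
      unfolding prod_border_last[of "?f (E A)"] 3
      by (intro arg_cong2[where f = "(*)"] prod.cong refl 1 2 4) auto
    also have "\<dots> = (g (Suc m) / g m) * (\<Prod>i<m. B (X i - Y m) / B 1) * (\<Prod>k<m. B (X m - Y k) / B 1) * (\<Prod>i<m. \<Prod>j<m. ?f A i j)"
      unfolding prod.distrib prod_telescope_down[where g = g, OF g] using g by (simp add: field_simps)
    finally show ?thesis by (simp add: g_def)
  qed
  have "Zh ?n X Y l = (\<Sum>A\<in>{A \<in> height_functions ?n. A m m = 0}. \<Prod>i<?n. \<Prod>j<?n. ?f A i j)"
    unfolding Zh_def by (rule sum.mono_neutral_right) (use zero in \<open>auto simp: finite_height_functions\<close>)
  also have "\<dots> = (\<Sum>A\<in>height_functions m. \<Prod>i<?n. \<Prod>j<?n. ?f (E A) i j)"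
  proof (rule sum.reindex_bij_witness[where i = E and j = F])
    fix A assume A': "A \<in> {A \<in> height_functions ?n. A m m = 0}"
    then have A: "A \<in> height_functions ?n" and A0: "A m m = 0" by auto
    \<comment> \<open>Falling from m to 0 in m unit steps leaves no choice; the same holds for the
      column.\<close>
    have r: "A m k = int (m - k)" if "k \<le> m" for k
      using height_lipschitz(1)[OF A, of m k m] height_lipschitz(1)[OF A, of m k 0] height_functionsD(4)[OF A, of m] A0 that
      by (auto simp: of_nat_diff)
    have c: "A k m = int (m - k)" if "k \<le> m" for k
      using height_lipschitz(2)[OF A, of m k m] height_lipschitz(2)[OF A, of m k 0] height_functionsD(3)[OF A, of m] A0 that
      by (auto simp: of_nat_diff)
    show EF: "E (F A) = A"
      using height_functionsD(5,6,7)[OF A] by (auto simp: fun_eq_iff E_def F_def le_Suc_eq not_le)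
    show "F A \<in> height_functions m"
      using height_functionsD[OF A] r c unfolding height_functions_def by (auto simp: F_def)
    show "(\<Prod>i<?n. \<Prod>j<?n. ?f (E (F A)) i j) = (\<Prod>i<?n. \<Prod>j<?n. ?f A i j)" unfolding EF ..
  next
    fix A assume A: "A \<in> height_functions m"
    show "F (E A) = A" using height_functionsD(7)[OF A] by (auto simp: fun_eq_iff E_def F_def not_le)
    have h: "\<bar>E A i (Suc j) - E A i j\<bar> = 1" if "i \<le> ?n" "j < ?n" for i j
      using that height_functionsD(1)[OF A, of i j] height_functionsD(6)[OF A, of i]
      by (cases "i = ?n"; cases "j = m") (auto simp: E_def of_nat_diff)
    have v: "\<bar>E A (Suc i) j - E A i j\<bar> = 1" if "i < ?n" "j \<le> ?n" for i j
      using that height_functionsD(2)[OF A, of i j] height_functionsD(5)[OF A, of j]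
      by (cases "i = m"; cases "j = ?n") (auto simp: E_def of_nat_diff)
    have b: "E A 0 k = int k \<and> E A k 0 = int k \<and> E A ?n k = int (?n - k) \<and> E A k ?n = int (?n - k)" if "k \<le> ?n" for k
      using that height_functionsD(3,4)[OF A, of k] by (auto simp: E_def)
    have "E A m m = 0" using height_functionsD(5)[OF A, of m] by (simp add: E_def)
    moreover have "E A i j = 0" if "i > ?n \<or> j > ?n" for i j using that by (auto simp: E_def)
    ultimately show "E A \<in> {A \<in> height_functions ?n. A m m = 0}"
      using h v b unfolding height_functions_def by blast
  qed
  also have "\<dots> = B (l + of_nat (Suc m)) / B (l + of_nat m)
    * (\<Prod>i<m. B (X i - Y m) / B 1) * (\<Prod>k<m. B (X m - Y k) / B 1) * Zh m X Y l"
    unfolding Zh_def sum_distrib_left by (rule sum.cong[OF refl weight])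
  finally show ?thesis .
qed

text \<open>The lower left block has u = 0, so its weight vanishes unless \<open>A m 1\<close> is m
  + 1. This fixes column 1 and row m. Without the first column and the last row of heights, a state
  of size m remains with all heights raised by 1, which is absorbed into \<lambda> + 1.\<close>

lemma Zh_freeze_first:
  assumes nz: "\<And>k :: int. B (l + of_int k) \<noteq> 0" and x: "X m = Y 0"
  shows "Zh (Suc m) X Y l = (\<Prod>i<m. B (X i - Y 0 + 1) / B 1) * (\<Prod>k<m. B (X m - Y (Suc k) + 1) / B 1)
    * Zh m X (\<lambda>k. Y (Suc k)) (l + 1)"
proof -
  let ?n = "Suc m"
  let ?f = "\<lambda>A i j. W l (A i j) (A i (Suc j)) (A (Suc i) j) (A (Suc i) (Suc j)) (X i - Y j)"
  let ?f' = "\<lambda>A i j. W (l + 1) (A i j) (A i (Suc j)) (A (Suc i) j) (A (Suc i) (Suc j)) (X i - Y (Suc j))"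
  define E where "E A = (\<lambda>i j. if i > ?n \<or> j > ?n then 0 else if i = ?n then int (?n - j)
    else if j = 0 then int i else A i (j - 1) + 1)" for A :: "nat \<Rightarrow> nat \<Rightarrow> int"
  define F where "F A = (\<lambda>i j. if i \<le> m \<and> j \<le> m then A i (Suc j) - 1 else 0)" for A :: "nat \<Rightarrow> nat \<Rightarrow> int"
  have zero: "(\<Prod>i<?n. \<Prod>j<?n. ?f A i j) = 0" if A: "A \<in> height_functions ?n" and "A m 1 \<noteq> int ?n" for A
  proof -
    have "A ?n 0 = int ?n" "A m 0 = int m" "A ?n 1 = int m"
      using height_functionsD(4)[OF A, of ?n] height_functionsD(4)[OF A, of m] height_functionsD(5)[OF A, of 1] by simp_all
    moreover have "\<bar>A m 1 - A m 0\<bar> = 1" using height_functionsD(1)[OF A, of m 0] by simp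
    then have "A m 1 = int m - 1" using \<open>A m 1 \<noteq> int ?n\<close> \<open>A m 0 = int m\<close> by (auto simp: abs_if split: if_splits)
    ultimately have "?f A m 0 = 0" using x by (simp add: W_def Rmat_def)
    then show ?thesis by (simp only: prod_border_first_column mult_zero_right mult_zero_left)
  qed
  have weight: "(\<Prod>i<?n. \<Prod>j<?n. ?f (E A) i j) = (\<Prod>i<m. B (X i - Y 0 + 1) / B 1) * (\<Prod>k<m. B (X m - Y (Suc k) + 1) / B 1)
     * (\<Prod>i<m. \<Prod>j<m. ?f' A i j)" if A: "A \<in> height_functions m" for A
  proof -
    have 1: "?f (E A) i 0 = B (X i - Y 0 + 1) / B 1" if "i < m" for i
      using that height_functionsD(4)[OF A, of i] height_functionsD(4)[OF A, of "Suc i"]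
      by (simp add: E_def W_def Rmat_def)
    have 2: "?f (E A) m (Suc j) = B (X m - Y (Suc j) + 1) / B 1" if "j < m" for j
      using that height_functionsD(5)[OF A, of j] height_functionsD(5)[OF A, of "Suc j"]
      by (simp add: E_def W_def Rmat_def of_nat_diff)
    have 3: "?f (E A) m 0 = 1"
      using height_functionsD(5)[OF A, of 0] x nz[of "int m"] by (simp add: E_def W_def Rmat_def)
    have 4: "?f (E A) i (Suc j) = ?f' A i j" if "i < m" "j < m" for i j
      using that W_shift[of l 1 "A i j" "A i (Suc j)" "A (Suc i) j" "A (Suc i) (Suc j)"] by (simp add: E_def add.commute)
    show ?thesis
      unfolding prod_border_first_column[of "?f (E A)"] 3 mult_1_right
      by (intro arg_cong2[where f = "(*)"] prod.cong refl 1 2 4) auto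
  qed
  have "Zh ?n X Y l = (\<Sum>A\<in>{A \<in> height_functions ?n. A m 1 = int ?n}. \<Prod>i<?n. \<Prod>j<?n. ?f A i j)"
    unfolding Zh_def by (rule sum.mono_neutral_right) (use zero in \<open>auto simp: finite_height_functions\<close>)
  also have "\<dots> = (\<Sum>A\<in>height_functions m. \<Prod>i<?n. \<Prod>j<?n. ?f (E A) i j)"
  proof (rule sum.reindex_bij_witness[where i = E and j = F])
    fix A assume A': "A \<in> {A \<in> height_functions ?n. A m 1 = int ?n}"
    then have A: "A \<in> height_functions ?n" and A1: "A m 1 = int ?n" by auto
    have r: "A m (Suc k) = int (m - k) + 1" if "k \<le> m" for k
      using height_lipschitz(1)[OF A, of m "Suc k" 1] height_lipschitz(1)[OF A, of m "Suc k" ?n]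
        height_functionsD(6)[OF A, of m] A1 that
      by (auto simp: of_nat_diff)
    have c: "A k 1 = int k + 1" if "k \<le> m" for k
      using height_lipschitz(2)[OF A, of 1 k m] height_lipschitz(2)[OF A, of 1 k 0] height_functionsD(3)[OF A, of 1] A1 that
      by auto
    show EF: "E (F A) = A"
      using height_functionsD(4,5,7)[OF A] by (auto simp: fun_eq_iff E_def F_def le_Suc_eq not_le not_less)
    show "F A \<in> height_functions m"
      using height_functionsD[OF A] r c unfolding height_functions_def by (auto simp: F_def)
    show "(\<Prod>i<?n. \<Prod>j<?n. ?f (E (F A)) i j) = (\<Prod>i<?n. \<Prod>j<?n. ?f A i j)" unfolding EF ..
  next
    fix A assume A: "A \<in> height_functions m"
    show "F (E A) = A" using height_functionsD(7)[OF A] by (auto simp: fun_eq_iff E_def F_def not_le)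
    have h: "\<bar>E A i (Suc j) - E A i j\<bar> = 1" if "i \<le> ?n" "j < ?n" for i j
      using that height_functionsD(1)[OF A, of i "j - 1"] height_functionsD(4)[OF A, of i]
      by (cases "i = ?n"; cases "j = 0") (auto simp: E_def of_nat_diff)
    have v: "\<bar>E A (Suc i) j - E A i j\<bar> = 1" if "i < ?n" "j \<le> ?n" for i j
      using that height_functionsD(2)[OF A, of i "j - 1"] height_functionsD(5)[OF A, of "j - 1"]
      by (cases "i = m"; cases "j = 0") (auto simp: E_def of_nat_diff)
    have b: "E A 0 k = int k \<and> E A k 0 = int k \<and> E A ?n k = int (?n - k) \<and> E A k ?n = int (?n - k)" if "k \<le> ?n" for k
      using that height_functionsD(3)[OF A, of "k - 1"] height_functionsD(6)[OF A, of k]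
      by (auto simp: E_def of_nat_diff)
    have "E A m 1 = int ?n" using height_functionsD(5)[OF A, of 0] by (simp add: E_def)
    moreover have "E A i j = 0" if "i > ?n \<or> j > ?n" for i j using that by (auto simp: E_def)
    ultimately show "E A \<in> {A \<in> height_functions ?n. A m 1 = int ?n}"
      using h v b unfolding height_functions_def by blast
  qed
  also have "\<dots> = (\<Prod>i<m. B (X i - Y 0 + 1) / B 1) * (\<Prod>k<m. B (X m - Y (Suc k) + 1) / B 1)
    * Zh m X (\<lambda>k. Y (Suc k)) (l + 1)"
    unfolding Zh_def sum_distrib_left by (rule sum.cong[OF refl weight])
  finally show ?thesis .
qed

end

section \<open>The sum of determinants\<close>


text \<open>\<open>skip j id\<close> is the increasing enumeration of the indices other than j, the
  same as for the columns of \<open>mat_delete\<close>.\<close>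

definition skip :: "nat \<Rightarrow> (nat \<Rightarrow> 'a) \<Rightarrow> nat \<Rightarrow> 'a" where
  "skip j Y k = (if k < j then Y k else Y (Suc k))"

lemma skip_image: "j \<le> m \<Longrightarrow> skip j id ` {..<m} = {..<Suc m} - {j}"
proof (intro equalityI subsetI)
  fix k assume j: "j \<le> m" and k: "k \<in> {..<Suc m} - {j}"
  show "k \<in> skip j id ` {..<m}"
  proof (cases "k < j")
    case True
    then show ?thesis using j k by (intro image_eqI[of _ _ k]) (auto simp: skip_def)
  next
    case False
    then show ?thesis using j k by (intro image_eqI[of _ _ "k - 1"]) (auto simp: skip_def)
  qed
qed (auto simp: skip_def split: if_splits)

lemma inj_skip_id: "inj_on (skip j id) S"
  by (auto simp: inj_on_def skip_def split: if_splits)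

lemma skip_apply: "skip j Y k = Y (skip j id k)"
  by (simp add: skip_def)

lemma prod_skip:
  fixes f :: "'a \<Rightarrow> 'b :: comm_monoid_mult"
  assumes "j \<le> m"
  shows "(\<Prod>k<m. f (skip j Y k)) = (\<Prod>k\<in>{..<Suc m} - {j}. f (Y k))"
  unfolding skip_image[OF assms, symmetric] prod.reindex[OF inj_skip_id] by (simp add: skip_apply[of j Y])

lemma prod_remove_skip:
  fixes f :: "'a \<Rightarrow> 'b :: comm_monoid_mult"
  assumes "j \<le> m"
  shows "(\<Prod>k<Suc m. f (Y k)) = f (Y j) * (\<Prod>k<m. f (skip j Y k))"
  using assms unfolding prod_skip[OF assms] by (intro prod.remove) auto

lemma sum_remove_skip:
  fixes Y :: "nat \<Rightarrow> 'b :: comm_monoid_add"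
  assumes "j \<le> m"
  shows "(\<Sum>k<Suc m. Y k) = Y j + (\<Sum>k<m. skip j Y k)"
proof -
  have "(\<Sum>k<m. skip j Y k) = (\<Sum>k\<in>{..<Suc m} - {j}. Y k)"
    unfolding skip_image[OF assms, symmetric] sum.reindex[OF inj_skip_id] by (simp add: skip_apply[of j Y])
  then show ?thesis using assms by (simp add: sum.remove[of "{..<Suc m}" j] del: sum.lessThan_Suc)
qed

lemma prod_skip_remove:
  fixes f :: "'a \<Rightarrow> 'b :: comm_monoid_mult"
  assumes "j \<le> m" "k < m"
  shows "(\<Prod>i\<in>{..<Suc m} - {skip j id k}. f (Y i)) = f (Y j) * (\<Prod>i\<in>{..<m} - {k}. f (skip j Y i))"
proof -
  have "skip j id k \<noteq> j" "skip j id k < Suc m" using assms by (auto simp: skip_def)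
  then have "{..<Suc m} - {skip j id k} = insert j ({..<Suc m} - {j} - {skip j id k})"
    using assms(1) by auto
  also have "{..<Suc m} - {j} - {skip j id k} = skip j id ` ({..<m} - {k})"
    unfolding skip_image[OF assms(1), symmetric] using inj_skip_id[of j UNIV] by (auto simp: inj_on_def)
  finally have *: "{..<Suc m} - {skip j id k} = insert j (skip j id ` ({..<m} - {k}))" .
  have "j \<notin> skip j id ` ({..<m} - {k})" by (auto simp: skip_def split: if_splits)
  then show ?thesis
    unfolding * by (subst prod.insert) (auto simp: prod.reindex[OF inj_skip_id] skip_apply[of j Y])
qed

lemma det_scale_rows:
  fixes c :: "nat \<Rightarrow> 'a :: comm_ring_1"
  shows "Determinant.det (Matrix.mat n n (\<lambda>(i, j). c i * f i j)) = (\<Prod>i<n. c i) * Determinant.det (Matrix.mat n n (\<lambda>(i, j). f i j))"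
proof -
  let ?A = "Matrix.mat n n (\<lambda>(i, j). c i * f i j)" and ?B = "Matrix.mat n n (\<lambda>(i, j). f i j)"
  have "(\<Prod>i = 0..<n. ?A $$ (i, p i)) = (\<Prod>i<n. c i) * (\<Prod>i = 0..<n. ?B $$ (i, p i))" if "p permutes {0..<n}" for p
  proof -
    have "p i < n" if "i < n" for i
      using \<open>p permutes {0..<n}\<close> that by (metis atLeastLessThan_iff permutes_in_image zero_le)
    then show ?thesis
      unfolding lessThan_atLeast0 prod.distrib[symmetric] by (intro prod.cong) auto
  qed
  then show ?thesis
    by (subst (1 2) det_def') (auto simp: sum_distrib_left mult_ac intro!: sum.cong)
qed

context theta
begin

text \<open>Freezing concerns an extreme column; adjacent swaps bring any \<open>Y j\<close>
  there.\<close>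

lemma Zh_move_last:
  assumes nz: "\<And>k :: int. B (l + of_int k) \<noteq> 0" and j: "j \<le> m"
    and r: "\<And>a b. a \<le> m \<Longrightarrow> b \<le> m \<Longrightarrow> a \<noteq> b \<Longrightarrow> B (Y a - Y b + 1) \<noteq> 0"
  shows "Zh (Suc m) X Y l = Zh (Suc m) X ((skip j Y)(m := Y j)) l"
proof -
  \<comment> \<open>\<open>S t\<close> is the stage at which entry \<open>j\<close> has travelled
    right to position t.\<close>
  define S where "S t k = (if k < j then Y k else if k < t then Y (Suc k) else if k = t then Y j else Y k)" for t k
  have "Zh (Suc m) X (S t) l = Zh (Suc m) X Y l" if "j \<le> t" "t \<le> m" for t
    using that
  proof (induction t rule: dec_induct)
    case base
    have "S j = Y" by (auto simp: S_def)
    then show ?case by simp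
  next
    case (step t)
    have "S (Suc t) = (S t)(t := S t (Suc t), Suc t := S t t)"
      using step by (auto simp: S_def fun_eq_iff)
    moreover have "B (S t (Suc t) - S t t + 1) \<noteq> 0"
      using r[of "Suc t" j] step by (simp add: S_def)
    ultimately show ?case using Zh_swap_adjacent[OF nz, of t "Suc m" "S t" X] step
      by (metis Suc_leD less_Suc_eq_le)
  qed
  from this[OF j le_refl] have "Zh (Suc m) X Y l = Zh (Suc m) X (S m) l" ..
  also have "\<dots> = Zh (Suc m) X ((skip j Y)(m := Y j)) l"
    using j by (intro Zh_cong) (auto simp: S_def skip_def)
  finally show ?thesis .
qed

lemma Zh_move_first:
  assumes nz: "\<And>k :: int. B (l + of_int k) \<noteq> 0" and j: "j \<le> m"
    and r: "\<And>a b. a \<le> m \<Longrightarrow> b \<le> m \<Longrightarrow> a \<noteq> b \<Longrightarrow> B (Y a - Y b + 1) \<noteq> 0"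
  shows "Zh (Suc m) X Y l = Zh (Suc m) X (\<lambda>k. case k of 0 \<Rightarrow> Y j | Suc k \<Rightarrow> skip j Y k) l"
proof -
  \<comment> \<open>Here entry \<open>j\<close> travels left, so the induction on its position t
    descends.\<close>
  define S where "S t k = (if k = t then Y j else if t < k \<and> k \<le> j then Y (k - 1) else Y k)" for t k
  have "Zh (Suc m) X (S t) l = Zh (Suc m) X Y l" if "t \<le> j" for t
    using that
  proof (induction t rule: inc_induct)
    case base
    have "S j = Y" by (auto simp: S_def)
    then show ?case by simp
  next
    case (step t)
    have "S t = (S (Suc t))(t := S (Suc t) (Suc t), Suc t := S (Suc t) t)"
      using step by (auto simp: S_def fun_eq_iff)
    moreover have "B (S (Suc t) (Suc t) - S (Suc t) t + 1) \<noteq> 0"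
      using r[of j t] step j by (simp add: S_def)
    ultimately show ?case using Zh_swap_adjacent[OF nz, of t "Suc m" "S (Suc t)" X] step j
      by (metis Suc_less_eq order_less_le_trans)
  qed
  from this[of 0] have "Zh (Suc m) X Y l = Zh (Suc m) X (S 0) l" by simp
  also have "\<dots> = Zh (Suc m) X (\<lambda>k. case k of 0 \<Rightarrow> Y j | Suc k \<Rightarrow> skip j Y k) l"
    using j by (intro Zh_cong) (auto simp: S_def skip_def split: nat.split)
  finally show ?thesis .
qed

section \<open>Vandermonde products and determinants without denominators\<close>

definition vandermonde :: "nat \<Rightarrow> (nat \<Rightarrow> complex) \<Rightarrow> complex" where
  "vandermonde n X = (\<Prod>j<n. \<Prod>i<j. B (X i - X j))"

lemma vandermonde_Suc: "vandermonde (Suc m) X = vandermonde m X * (\<Prod>i<m. B (X i - X m))"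
  by (simp add: vandermonde_def)

lemma vandermonde_cong: "(\<And>i. i < n \<Longrightarrow> X i = X' i) \<Longrightarrow> vandermonde n X = vandermonde n X'"
  unfolding vandermonde_def by (intro prod.cong) auto

text \<open>The sign comes from reversing the j factors [y_i - y_j] with i < j; it will match the
  sign of the Laplace expansion.\<close>

lemma vandermonde_skip:
  "j \<le> m \<Longrightarrow> vandermonde (Suc m) Y = (- 1) ^ j * (\<Prod>k<m. B (Y j - skip j Y k)) * vandermonde m (skip j Y)"
proof (induction m)
  case 0
  then show ?case by (simp add: vandermonde_def)
next
  case (Suc m)
  show ?case
  proof (cases "j = Suc m")
    case True
    have "(\<Prod>i<Suc m. B (Y i - Y (Suc m))) = (\<Prod>i<Suc m. (- 1) * B (Y (Suc m) - Y i))"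
      by (intro prod.cong refl) (metis B_minus minus_diff_eq mult_minus1)
    also have "\<dots> = (- 1) ^ Suc m * (\<Prod>k<Suc m. B (Y j - skip j Y k))"
      unfolding prod.distrib using True by (simp add: skip_def)
    finally have "(\<Prod>i<Suc m. B (Y i - Y (Suc m))) = (- 1) ^ Suc m * (\<Prod>k<Suc m. B (Y j - skip j Y k))" .
    moreover have "vandermonde (Suc m) Y = vandermonde (Suc m) (skip j Y)"
      using True by (intro vandermonde_cong) (simp add: skip_def)
    ultimately show ?thesis using vandermonde_Suc[of "Suc m" Y] True by (simp add: mult_ac)
  next
    case False
    then have j: "j \<le> m" using Suc.prems by simp
    have "skip j Y m = Y (Suc m)" using j by (simp add: skip_def)
    then show ?thesis
      using vandermonde_Suc[of "Suc m" Y] vandermonde_Suc[of m "skip j Y"] Suc.IH[OF j]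
        prod_remove_skip[OF j, of "\<lambda>y. B (y - Y (Suc m))" Y]
      by (simp add: mult_ac)
  qed
qed

text \<open>Passing from \<open>S\<close> to \<open>- S\<close> gives the other of
  \<open>X i\<close> and \<open>X i + 1\<close>; together they form the unordered pair from which
  each row is cleared.\<close>

definition shifted :: "(nat \<Rightarrow> complex) \<Rightarrow> nat set \<Rightarrow> nat \<Rightarrow> complex" where
  "shifted X S i = (if i \<in> S then X i + 1 else X i)"

text \<open>The entry \<open>[z - y\<^sub>j + g] / [z - y\<^sub>j]\<close>, where \<open>z\<close> and \<open>z'\<close> are \<open>x\<^sub>i\<close> and \<open>x\<^sub>i + 1\<close> in either order,
  multiplied by \<open>\<Prod>\<^sub>k [x\<^sub>i - y\<^sub>k] [x\<^sub>i + 1 - y\<^sub>k]\<close>.\<close>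

definition entry :: "nat \<Rightarrow> (nat \<Rightarrow> complex) \<Rightarrow> complex \<Rightarrow> complex \<Rightarrow> complex \<Rightarrow> nat \<Rightarrow> complex" where
  "entry n Y g z z' j = B (z - Y j + g) * (\<Prod>k\<in>{..<n} - {j}. B (z - Y k)) * (\<Prod>k<n. B (z' - Y k))"

text \<open>Free of denominators, this remains meaningful at the nodes \<open>X m = Y j\<close> and
  \<open>X m = Y j - 1\<close>.\<close>

definition dets :: "nat \<Rightarrow> (nat \<Rightarrow> complex) \<Rightarrow> (nat \<Rightarrow> complex) \<Rightarrow> complex \<Rightarrow> nat set \<Rightarrow> complex" where
  "dets n X Y g S = Determinant.det (Matrix.mat n n (\<lambda>(i, j). entry n Y g (shifted X S i) (shifted X (- S) i) j))"

definition det_sum :: "nat \<Rightarrow> (nat \<Rightarrow> complex) \<Rightarrow> (nat \<Rightarrow> complex) \<Rightarrow> complex \<Rightarrow> complex \<Rightarrow> complex" where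
  "det_sum n X Y l g = (\<Sum>S\<in>Pow {..<n}. (- 1) ^ card S
     * (B (l + g + of_nat n - of_nat (card S)) / B (l + of_nat n - of_nat (card S))) * dets n X Y g S)"

lemma dets_cong:
  assumes "\<And>i. i < n \<Longrightarrow> X i = X' i" "\<And>i. i < n \<Longrightarrow> i \<in> S \<longleftrightarrow> i \<in> S'"
  shows "dets n X Y g S = dets n X' Y g S'"
  unfolding dets_def using assms by (intro arg_cong[where f = Determinant.det] eq_matI) (auto simp: shifted_def)

lemma det_sum_cong: "(\<And>i. i < n \<Longrightarrow> X i = X' i) \<Longrightarrow> det_sum n X Y l g = det_sum n X' Y l g"
  unfolding det_sum_def using dets_cong[of n X X'] by (intro sum.cong refl) simp

lemma entry_skip:
  assumes "j \<le> m" "k < m"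
  shows "entry (Suc m) Y g z z' (skip j id k) = (B (z - Y j) * B (z' - Y j)) * entry m (skip j Y) g z z' k"
  using prod_skip_remove[OF assms, of "\<lambda>y. B (z - y)" Y] prod_remove_skip[OF assms(1), of "\<lambda>y. B (z' - y)" Y]
  by (simp add: entry_def mult_ac skip_apply[of j Y k])

text \<open>Laplace expansion along the last row. With column j deleted, each other row keeps the
  factor [x_i - y_j][x_i + 1 - y_j], which is symmetric in the pair x_i, x_i + 1 and hence
  independent of S.\<close>

lemma dets_Suc:
  "dets (Suc m) X Y g S = (\<Sum>j<Suc m. entry (Suc m) Y g (shifted X S m) (shifted X (- S) m) j
     * ((- 1) ^ (m + j) * (\<Prod>i<m. B (X i - Y j) * B (X i + 1 - Y j)) * dets m X (skip j Y) g S))"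
proof -
  let ?M = "Matrix.mat (Suc m) (Suc m) (\<lambda>(i, j). entry (Suc m) Y g (shifted X S i) (shifted X (- S) i) j)"
  have "Determinant.det (mat_delete ?M m j) = (\<Prod>i<m. B (X i - Y j) * B (X i + 1 - Y j)) * dets m X (skip j Y) g S"
    if j: "j \<le> m" for j
  proof -
    have "mat_delete ?M m j = Matrix.mat m m (\<lambda>(i, k). (B (X i - Y j) * B (X i + 1 - Y j))
        * entry m (skip j Y) g (shifted X S i) (shifted X (- S) i) k)"
    proof (rule eq_matI)
      fix i k assume ik: "i < dim_row (Matrix.mat m m (\<lambda>(i, k). (B (X i - Y j) * B (X i + 1 - Y j))
        * entry m (skip j Y) g (shifted X S i) (shifted X (- S) i) k))" "k < dim_col (Matrix.mat m m (\<lambda>(i, k). (B (X i - Y j) * B (X i + 1 - Y j))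
        * entry m (skip j Y) g (shifted X S i) (shifted X (- S) i) k))"
      have "B (shifted X S i - Y j) * B (shifted X (- S) i - Y j) = B (X i - Y j) * B (X i + 1 - Y j)"
        by (simp add: shifted_def mult.commute)
      moreover have "mat_delete ?M m j $$ (i, k) = entry (Suc m) Y g (shifted X S i) (shifted X (- S) i) (skip j id k)"
        using ik by (simp add: mat_delete_def skip_def)
      ultimately show "mat_delete ?M m j $$ (i, k) = Matrix.mat m m (\<lambda>(i, k). (B (X i - Y j) * B (X i + 1 - Y j))
        * entry m (skip j Y) g (shifted X S i) (shifted X (- S) i) k) $$ (i, k)"
        using entry_skip[OF j, of k Y g "shifted X S i" "shifted X (- S) i"] ik by simp
    qed (simp_all add: mat_delete_def)
    then show ?thesis unfolding dets_def by (simp add: det_scale_rows)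
  qed
  then show ?thesis
    unfolding dets_def[of "Suc m"]
    by (subst laplace_expansion_row[of _ "Suc m" m]) (auto simp: cofactor_def mult_ac intro!: sum.cong)
qed

text \<open>Subsets are split by membership of m. Without m, the size drops but |S| does not, so
  \<lambda> becomes \<lambda> + 1; with m, both drop, \<lambda> stays and the sign changes.\<close>

lemma det_sum_Suc:
  "det_sum (Suc m) X Y l g = (\<Sum>j<Suc m. ((- 1) ^ (m + j) * (\<Prod>i<m. B (X i - Y j) * B (X i + 1 - Y j)))
     * (entry (Suc m) Y g (X m) (X m + 1) j * det_sum m X (skip j Y) (l + 1) g
      - entry (Suc m) Y g (X m + 1) (X m) j * det_sum m X (skip j Y) l g))"
proof -
  define K where "K j = (- 1) ^ (m + j) * (\<Prod>i<m. B (X i - Y j) * B (X i + 1 - Y j))" for j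
  define c where "c n l S = (- 1) ^ card S * (B (l + g + of_nat n - of_nat (card S)) / B (l + of_nat n - of_nat (card S)))"
    for n l and S :: "nat set"
  have inj: "inj_on (insert m) (Pow {..<m})"
    by (rule inj_onI) (metis Diff_insert_absorb PowD insert_absorb lessThan_iff less_irrefl subsetD)
  have disj: "Pow {..<m} \<inter> insert m ` Pow {..<m} = {}" by auto
  have S0: "c (Suc m) l S * dets (Suc m) X Y g S
      = (\<Sum>j<Suc m. K j * entry (Suc m) Y g (X m) (X m + 1) j * (c m (l + 1) S * dets m X (skip j Y) g S))"
    if "S \<in> Pow {..<m}" for S
  proof -
    have "c (Suc m) l S = c m (l + 1) S" by (simp add: c_def add_ac)
    moreover have "shifted X S m = X m" "shifted X (- S) m = X m + 1" using that by (auto simp: shifted_def)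
    ultimately show ?thesis unfolding dets_Suc by (simp add: K_def sum_distrib_left mult_ac del: sum.lessThan_Suc)
  qed
  have S1: "c (Suc m) l (insert m S) * dets (Suc m) X Y g (insert m S)
      = (\<Sum>j<Suc m. - K j * entry (Suc m) Y g (X m + 1) (X m) j * (c m l S * dets m X (skip j Y) g S))"
    if "S \<in> Pow {..<m}" for S
  proof -
    have "finite S" "m \<notin> S" using that finite_subset by auto
    then have "c (Suc m) l (insert m S) = - c m l S" by (simp add: c_def algebra_simps)
    moreover have "shifted X (insert m S) m = X m + 1" "shifted X (- insert m S) m = X m" by (auto simp: shifted_def)
    moreover have "dets m X (skip j Y) g (insert m S) = dets m X (skip j Y) g S" for j
      by (rule dets_cong) auto
    ultimately show ?thesis unfolding dets_Suc by (simp add: K_def sum_distrib_left mult_ac sum_negf del: sum.lessThan_Suc)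
  qed
  have "det_sum (Suc m) X Y l g = (\<Sum>S\<in>Pow {..<m}. c (Suc m) l S * dets (Suc m) X Y g S)
      + (\<Sum>S\<in>Pow {..<m}. c (Suc m) l (insert m S) * dets (Suc m) X Y g (insert m S))"
    unfolding det_sum_def c_def[symmetric] lessThan_Suc Pow_insert
    by (subst sum.union_disjoint[OF _ _ disj]) (simp_all add: sum.reindex[OF inj])
  also have "\<dots> = (\<Sum>j<Suc m. K j * entry (Suc m) Y g (X m) (X m + 1) j * det_sum m X (skip j Y) (l + 1) g)
      + (\<Sum>j<Suc m. - K j * entry (Suc m) Y g (X m + 1) (X m) j * det_sum m X (skip j Y) l g)"
  proof (rule arg_cong2[where f = "(+)"])
    have "(\<Sum>S\<in>Pow {..<m}. c (Suc m) l S * dets (Suc m) X Y g S)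
      = (\<Sum>S\<in>Pow {..<m}. \<Sum>j<Suc m. K j * entry (Suc m) Y g (X m) (X m + 1) j * (c m (l + 1) S * dets m X (skip j Y) g S))"
      by (rule sum.cong[OF refl S0])
    also have "\<dots> = (\<Sum>j<Suc m. K j * entry (Suc m) Y g (X m) (X m + 1) j * det_sum m X (skip j Y) (l + 1) g)"
      unfolding det_sum_def c_def[symmetric] sum_distrib_left by (rule sum.swap)
    finally show "(\<Sum>S\<in>Pow {..<m}. c (Suc m) l S * dets (Suc m) X Y g S) = \<dots>" .
    have "(\<Sum>S\<in>Pow {..<m}. c (Suc m) l (insert m S) * dets (Suc m) X Y g (insert m S))
      = (\<Sum>S\<in>Pow {..<m}. \<Sum>j<Suc m. - K j * entry (Suc m) Y g (X m + 1) (X m) j * (c m l S * dets m X (skip j Y) g S))"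
      by (rule sum.cong[OF refl S1])
    also have "\<dots> = (\<Sum>j<Suc m. - K j * entry (Suc m) Y g (X m + 1) (X m) j * det_sum m X (skip j Y) l g)"
      unfolding det_sum_def c_def[symmetric] sum_distrib_left by (rule sum.swap)
    finally show "(\<Sum>S\<in>Pow {..<m}. c (Suc m) l (insert m S) * dets (Suc m) X Y g (insert m S)) = \<dots>" .
  qed
  also have "\<dots> = (\<Sum>j<Suc m. K j * (entry (Suc m) Y g (X m) (X m + 1) j * det_sum m X (skip j Y) (l + 1) g
      - entry (Suc m) Y g (X m + 1) (X m) j * det_sum m X (skip j Y) l g))"
    by (simp add: sum.distrib[symmetric] algebra_simps del: sum.lessThan_Suc)
  finally show ?thesis by (simp add: K_def)
qed

section \<open>Interpolation in the last spectral parameter\<close>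

lemma entry_at_zero: "j < n \<Longrightarrow> B (z' - Y j) = 0 \<Longrightarrow> entry n Y g z z' k = 0"
  unfolding entry_def by (auto intro!: prod_zero)

lemma entry_at_y: "j < n \<Longrightarrow> k \<noteq> j \<Longrightarrow> B (z - Y j) = 0 \<Longrightarrow> entry n Y g z z' k = 0"
  unfolding entry_def by (auto intro!: prod_zero)

text \<open>Here [x_m + 1 - y_j] = 0. It divides every entry of the first kind, and of the second
  kind every entry outside column j. The factor [x_m - y_j] = -[1] cancels the sign of the second
  kind.\<close>

lemma det_sum_Suc_at_y_minus_1:
  assumes j: "j \<le> m" and x: "X m = Y j - 1"
  shows "det_sum (Suc m) X Y l g = (- 1) ^ (m + j) * (\<Prod>i<m. B (X i - Y j) * B (X i + 1 - Y j))
    * (B 1 * B g * (\<Prod>k<m. B (Y j - skip j Y k)) * (\<Prod>k<m. B (X m - skip j Y k))) * det_sum m X (skip j Y) l g"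
proof -
  have "entry (Suc m) Y g (X m + 1) (X m) j = - (B 1 * B g * (\<Prod>k<m. B (Y j - skip j Y k)) * (\<Prod>k<m. B (X m - skip j Y k)))"
    unfolding entry_def using prod_skip[OF j, of "\<lambda>y. B (Y j - y)" Y] prod_remove_skip[OF j, of "\<lambda>y. B (X m - y)" Y] x B_minus[of 1]
    by (simp del: prod.lessThan_Suc)
  moreover have "entry (Suc m) Y g (X m) (X m + 1) k = 0" for k
    using j x by (intro entry_at_zero[of j]) auto
  moreover have "entry (Suc m) Y g (X m + 1) (X m) k = 0" if "k \<noteq> j" for k
    using j x that by (intro entry_at_y[of j]) auto
  ultimately show ?thesis
    unfolding det_sum_Suc using j by (subst sum.remove[of _ j]) (auto simp del: sum.lessThan_Suc)
qed

text \<open>The same with x_m and x_m + 1 exchanged: now [x_m - y_j] = 0 and the first kind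
  survives.\<close>

lemma det_sum_Suc_at_y:
  assumes j: "j \<le> m" and x: "X m = Y j"
  shows "det_sum (Suc m) X Y l g = (- 1) ^ (m + j) * (\<Prod>i<m. B (X i - Y j) * B (X i + 1 - Y j))
    * (B 1 * B g * (\<Prod>k<m. B (Y j - skip j Y k)) * (\<Prod>k<m. B (X m + 1 - skip j Y k))) * det_sum m X (skip j Y) (l + 1) g"
proof -
  have "entry (Suc m) Y g (X m) (X m + 1) j = B 1 * B g * (\<Prod>k<m. B (Y j - skip j Y k)) * (\<Prod>k<m. B (X m + 1 - skip j Y k))"
    unfolding entry_def using prod_skip[OF j, of "\<lambda>y. B (Y j - y)" Y] prod_remove_skip[OF j, of "\<lambda>y. B (X m + 1 - y)" Y] x
    by (simp del: prod.lessThan_Suc)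
  moreover have "entry (Suc m) Y g (X m + 1) (X m) k = 0" for k
    using j x by (intro entry_at_zero[of j]) auto
  moreover have "entry (Suc m) Y g (X m) (X m + 1) k = 0" if "k \<noteq> j" for k
    using j x that by (intro entry_at_y[of j]) auto
  ultimately show ?thesis
    unfolding det_sum_Suc using j by (subst sum.remove[of _ j]) (auto simp del: sum.lessThan_Suc)
qed

text \<open>In both orders exactly n = m + 1 of the 2n factors carry the shift by 1, so the
  multipliers agree and do not depend on j.\<close>

lemma theta_fun_entry:
  assumes "j \<le> m"
  shows "theta_fun (2 * Suc m) (2 * (\<Sum>k<Suc m. Y k) - g - of_nat (Suc m)) (\<lambda>z. entry (Suc m) Y g z (z + 1) j)" (is ?A)
    and "theta_fun (2 * Suc m) (2 * (\<Sum>k<Suc m. Y k) - g - of_nat (Suc m)) (\<lambda>z. entry (Suc m) Y g (z + 1) z j)" (is ?B)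
proof -
  let ?K = "{..<Suc m} - {j}"
  have c: "card ?K = m" using assms by simp
  have s: "(\<Sum>k\<in>?K. Y k) = (\<Sum>k<Suc m. Y k) - Y j"
    using assms by (simp add: sum.remove[of "{..<Suc m}" j] del: sum.lessThan_Suc)
  have N: "1 + card ?K + card {..<Suc m} = 2 * Suc m" using c by simp
  have tA: "(Y j - g) + (\<Sum>k\<in>?K. Y k) + (\<Sum>k<Suc m. Y k - 1) = 2 * (\<Sum>k<Suc m. Y k) - g - of_nat (Suc m)"
    unfolding s sum_subtractf by simp
  have tB: "(Y j - (1 + g)) + (\<Sum>k\<in>?K. Y k - 1) + (\<Sum>k<Suc m. Y k) = 2 * (\<Sum>k<Suc m. Y k) - g - of_nat (Suc m)"
    unfolding s sum_subtractf using c by simp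
  have "theta_fun (1 + card ?K + card {..<Suc m}) ((Y j - g) + (\<Sum>k\<in>?K. Y k) + (\<Sum>k<Suc m. Y k - 1))
     (\<lambda>z. B (z + g - Y j) * (\<Prod>k\<in>?K. B (z - Y k)) * (\<Prod>k<Suc m. B (z + 1 - Y k)))"
    by (intro theta_fun_mult theta_fun_prod theta_fun_B theta_fun_B_shift) auto
  moreover have "z + g - Y j = z - Y j + g" for z by simp
  ultimately show ?A unfolding entry_def N tA by simp
  have "theta_fun (1 + card ?K + card {..<Suc m}) ((Y j - (1 + g)) + (\<Sum>k\<in>?K. Y k - 1) + (\<Sum>k<Suc m. Y k))
     (\<lambda>z. B (z + (1 + g) - Y j) * (\<Prod>k\<in>?K. B (z + 1 - Y k)) * (\<Prod>k<Suc m. B (z - Y k)))"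
    by (intro theta_fun_mult theta_fun_prod theta_fun_B theta_fun_B_shift) auto
  moreover have "z + (1 + g) - Y j = z + 1 - Y j + g" for z by simp
  ultimately show ?B unfolding entry_def N tB by simp
qed

lemma theta_fun_det_sum:
  "theta_fun (2 * Suc m) (2 * (\<Sum>k<Suc m. Y k) - g - of_nat (Suc m)) (\<lambda>z. det_sum (Suc m) (X(m := z)) Y l g)"
proof -
  have "det_sum (Suc m) (X(m := z)) Y l g = (\<Sum>j<Suc m. ((- 1) ^ (m + j) * (\<Prod>i<m. B (X i - Y j) * B (X i + 1 - Y j)))
     * (det_sum m X (skip j Y) (l + 1) g * entry (Suc m) Y g z (z + 1) j
      - det_sum m X (skip j Y) l g * entry (Suc m) Y g (z + 1) z j))" for z
  proof -
    have "det_sum m (X(m := z)) Y' l' g = det_sum m X Y' l' g" for Y' l' by (rule det_sum_cong) simp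
    moreover have "(\<Prod>i<m. B ((X(m := z)) i - Y j) * B ((X(m := z)) i + 1 - Y j)) = (\<Prod>i<m. B (X i - Y j) * B (X i + 1 - Y j))" for j
      by (rule prod.cong) auto
    ultimately show ?thesis unfolding det_sum_Suc by (simp add: mult.commute del: sum.lessThan_Suc)
  qed
  moreover have "theta_fun (2 * Suc m) (2 * (\<Sum>k<Suc m. Y k) - g - of_nat (Suc m)) (\<lambda>z. \<Sum>j<Suc m. ((- 1) ^ (m + j) * (\<Prod>i<m. B (X i - Y j) * B (X i + 1 - Y j)))
     * (det_sum m X (skip j Y) (l + 1) g * entry (Suc m) Y g z (z + 1) j
      - det_sum m X (skip j Y) l g * entry (Suc m) Y g (z + 1) z j))"
    by (intro theta_fun_sum theta_fun_cmult theta_fun_diff theta_fun_entry) auto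
  ultimately show ?thesis by simp
qed

definition scaled_Z :: "nat \<Rightarrow> (nat \<Rightarrow> complex) \<Rightarrow> (nat \<Rightarrow> complex) \<Rightarrow> complex \<Rightarrow> complex \<Rightarrow> complex" where
  "scaled_Z n X Y l g = B 1 ^ (n\<^sup>2) * B g ^ n * B ((\<Sum>i<n. X i) - (\<Sum>j<n. Y j) + l + g + of_nat n)
     * vandermonde n X * vandermonde n Y * Zh n X Y l"

definition scaled_dets :: "nat \<Rightarrow> (nat \<Rightarrow> complex) \<Rightarrow> (nat \<Rightarrow> complex) \<Rightarrow> complex \<Rightarrow> complex \<Rightarrow> complex" where
  "scaled_dets n X Y l g = (- 1) ^ (n choose 2) * B (l + of_nat n) * det_sum n X Y l g"

text \<open>The order is n from the partition function, n - 1 from the Vandermonde product and 1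
  from [|x| - |y| + \<lambda> + \<gamma> + n]. The argument of the last factor is such that the
  other x_i and \<lambda> cancel in the zero sum, leaving that of the determinant side.\<close>

lemma theta_fun_scaled_Z:
  "theta_fun (2 * Suc m) (2 * (\<Sum>k<Suc m. Y k) - g - of_nat (Suc m)) (\<lambda>z. scaled_Z (Suc m) (X(m := z)) Y l g)"
proof -
  let ?n = "Suc m"
  define s where "s = (\<Sum>k<m. X k) - (\<Sum>k<?n. Y k) + l + g + of_nat ?n"
  define c where "c = B 1 ^ (?n\<^sup>2) * B g ^ ?n * vandermonde m X * vandermonde ?n Y"
  have eq: "scaled_Z ?n (X(m := z)) Y l g = c * (B (z - (- s)) * (\<Prod>i<m. B (X i - z)) * Zh ?n (X(m := z)) Y l)" for z
  proof -
    have "vandermonde ?n (X(m := z)) = vandermonde m X * (\<Prod>i<m. B (X i - z))"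
      unfolding vandermonde_Suc using vandermonde_cong[of m "X(m := z)" X] by simp
    moreover have "(\<Sum>k<?n. (X(m := z)) k) = z + (\<Sum>k<m. X k)" by simp
    ultimately show ?thesis by (simp add: scaled_Z_def c_def s_def algebra_simps del: sum.lessThan_Suc)
  qed
  have "theta_fun (1 + card {..<m} + ?n) (- s + (\<Sum>i<m. X i) + ((\<Sum>j<?n. Y j) + l))
      (\<lambda>z. B (z - (- s)) * (\<Prod>i<m. B (X i - z)) * Zh ?n (X(m := z)) Y l)"
    by (intro theta_fun_mult theta_fun_B theta_fun_prod theta_fun_B_neg theta_fun_Zh_last_row) auto
  moreover have "1 + card {..<m} + ?n = 2 * ?n" by simp
  moreover have "- s + (\<Sum>i<m. X i) + ((\<Sum>j<?n. Y j) + l) = 2 * (\<Sum>k<?n. Y k) - g - of_nat ?n"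
    by (simp add: s_def)
  ultimately have "theta_fun (2 * ?n) (2 * (\<Sum>k<?n. Y k) - g - of_nat ?n)
      (\<lambda>z. B (z - (- s)) * (\<Prod>i<m. B (X i - z)) * Zh ?n (X(m := z)) Y l)"
    by metis
  with eq show ?thesis by (simp only: theta_fun_cmult)
qed

lemma choose_two_Suc: "(- 1 :: complex) ^ (Suc m choose 2) = (- 1) ^ m * (- 1) ^ (m choose 2)"
  by (simp add: numeral_2_eq_2 power_add)

text \<open>The condition on \<lambda> is stable under \<lambda> + 1 and the one on y under deletion
  of an entry, as the induction demands. X is free, since interpolation reaches every value of the
  last x.\<close>

lemma scaled_Z_eq_scaled_dets_generic:
  assumes "\<And>k :: int. B (l + of_int k) \<noteq> 0"
    and "\<And>a b. a < n \<Longrightarrow> b < n \<Longrightarrow> a \<noteq> b \<Longrightarrow> B (Y a - Y b) \<noteq> 0 \<and> B (Y a - Y b + 1) \<noteq> 0"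
    and g: "B g \<noteq> 0"
  shows "scaled_Z n X Y l g = scaled_dets n X Y l g"
  using assms(1,2)
proof (induction n arbitrary: X Y l)
  case 0
  have "det_sum 0 X Y l g = B (l + g) / B l" by (simp add: det_sum_def dets_def)
  moreover have "Zh 0 X Y l = 1" by (simp add: Zh_def height_functions_0)
  ultimately show ?case using "0.prems"(1)[of 0] by (simp add: scaled_Z_def scaled_dets_def vandermonde_def numeral_2_eq_2)
next
  case (Suc m)
  let ?n = "Suc m"
  note nz = Suc.prems(1) and Y = Suc.prems(2)
  have nz1: "B (l + 1 + of_int k) \<noteq> 0" for k using nz[of "k + 1"] by (simp add: add_ac)
  have r: "a \<le> m \<Longrightarrow> b \<le> m \<Longrightarrow> a \<noteq> b \<Longrightarrow> B (Y a - Y b + 1) \<noteq> 0" for a b using Y[of a b] by simp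
  have Yskip: "B (skip j Y a - skip j Y b) \<noteq> 0 \<and> B (skip j Y a - skip j Y b + 1) \<noteq> 0"
    if "a < m" "b < m" "a \<noteq> b" for j a b
    using that unfolding skip_apply[of j Y] by (intro Y) (auto simp: skip_def)
  have B1: "B 1 ^ (?n\<^sup>2) = B 1 * B 1 ^ (m\<^sup>2) * (B 1 ^ m * B 1 ^ m)"
    by (simp add: power2_eq_square power_add mult_ac)
  have S: "(\<Sum>i<?n. X i) - (\<Sum>j<?n. Y j) + l + g + of_nat ?n
      = (\<Sum>i<m. X i) - (\<Sum>k<m. skip j Y k) + l + g + of_nat m + (X m - Y j + 1)" if "j \<le> m" for X j
    using sum_remove_skip[OF that, of Y] by (simp add: algebra_simps)
  \<comment> \<open>The sign (-1)^m from the binomial exponent and (-1)^(m + j) from Laplace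
    expansion leave the (-1)^j of \<open>vandermonde_skip\<close>.\<close>
  have sgn: "(- 1 :: complex) ^ m * (- 1) ^ (m + j) = (- 1) ^ j" for j
    by (simp add: power_add flip: mult.assoc power_mult_distrib)
  have at_y_minus_1: "scaled_Z ?n X Y l g = scaled_dets ?n X Y l g" if j: "j \<le> m" and x: "X m = Y j - 1" for X j
  proof -
    define P where "P = (\<Prod>i<m. B (X i - Y j))"
    define P' where "P' = (\<Prod>i<m. B (X i + 1 - Y j))"
    define R where "R = (\<Prod>k<m. B (Y j - skip j Y k))"
    define R' where "R' = (\<Prod>k<m. B (X m - skip j Y k))"
    have IH: "scaled_Z m X (skip j Y) l g = scaled_dets m X (skip j Y) l g"
      by (rule Suc.IH[OF nz Yskip])
    have "Zh ?n X Y l = Zh ?n X ((skip j Y)(m := Y j)) l"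
      by (rule Zh_move_last[OF nz j r])
    also have "\<dots> = B (l + of_nat (Suc m)) / B (l + of_nat m)
        * (\<Prod>i<m. B (X i - Y j) / B 1) * (\<Prod>k<m. B (X m - skip j Y k) / B 1) * Zh m X (skip j Y) l"
    proof -
      have "X m = ((skip j Y)(m := Y j)) m - 1" using x by simp
      moreover have "(\<Prod>k<m. B (X m - ((skip j Y)(m := Y j)) k) / B 1) = (\<Prod>k<m. B (X m - skip j Y k) / B 1)"
        by (rule prod.cong) auto
      moreover have "Zh m X ((skip j Y)(m := Y j)) l = Zh m X (skip j Y) l"
        by (rule Zh_cong) auto
      ultimately show ?thesis using Zh_freeze_last[OF nz, of X m "(skip j Y)(m := Y j)"] by simp
    qed
    finally have Z: "Zh ?n X Y l = B (l + of_nat ?n) / B (l + of_nat m) * (P / B 1 ^ m) * (R' / B 1 ^ m) * Zh m X (skip j Y) l"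
      by (simp add: P_def R'_def prod_dividef)
    have VX: "vandermonde ?n X = vandermonde m X * P'"
    proof -
      have "X i - X m = X i + 1 - Y j" for i using x by simp
      then show ?thesis by (simp only: vandermonde_Suc P'_def)
    qed
    have VY: "vandermonde ?n Y = (- 1) ^ j * R * vandermonde m (skip j Y)"
      unfolding R_def by (rule vandermonde_skip[OF j])
    have D: "det_sum ?n X Y l g = (- 1) ^ (m + j) * (P * P') * (B 1 * B g * R * R') * det_sum m X (skip j Y) l g"
      using det_sum_Suc_at_y_minus_1[where X = X and Y = Y and l = l and g = g, OF j x] by (simp add: P_def P'_def R_def R'_def prod.distrib)
    define w where "w = B ((\<Sum>i<m. X i) - (\<Sum>k<m. skip j Y k) + l + g + of_nat m)"
    have Bl: "B (l + of_nat m) \<noteq> 0" using nz[of "int m"] by simp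
    have "scaled_Z ?n X Y l g * B (l + of_nat m) = scaled_Z m X (skip j Y) l g * (B 1 * B g * P' * ((- 1) ^ j * R) * B (l + of_nat ?n) * P * R')"
      unfolding scaled_Z_def S[OF j] Z VX VY B1 using x Bl B_1 by (simp add: field_simps)
    also have "\<dots> = scaled_dets ?n X Y l g * B (l + of_nat m)"
      unfolding IH scaled_dets_def D choose_two_Suc sgn[of j, symmetric] by (simp add: mult_ac)
    finally show ?thesis using Bl by simp
  qed
  have at_y: "scaled_Z ?n X Y l g = scaled_dets ?n X Y l g" if j: "j \<le> m" and x: "X m = Y j" for X j
  proof -
    define P where "P = (\<Prod>i<m. B (X i - Y j))"
    define P' where "P' = (\<Prod>i<m. B (X i + 1 - Y j))"
    define R where "R = (\<Prod>k<m. B (Y j - skip j Y k))"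
    define R' where "R' = (\<Prod>k<m. B (X m + 1 - skip j Y k))"
    have IH: "scaled_Z m X (skip j Y) (l + 1) g = scaled_dets m X (skip j Y) (l + 1) g"
      by (rule Suc.IH[OF nz1 Yskip])
    have "Zh ?n X Y l = Zh ?n X (\<lambda>k. case k of 0 \<Rightarrow> Y j | Suc k \<Rightarrow> skip j Y k) l"
      by (rule Zh_move_first[OF nz j r])
    also have "\<dots> = (\<Prod>i<m. B (X i - Y j + 1) / B 1) * (\<Prod>k<m. B (X m - skip j Y k + 1) / B 1) * Zh m X (skip j Y) (l + 1)"
      using Zh_freeze_first[OF nz, of X m "\<lambda>k. case k of 0 \<Rightarrow> Y j | Suc k \<Rightarrow> skip j Y k"] x by simp
    finally have Z: "Zh ?n X Y l = (P' / B 1 ^ m) * (R' / B 1 ^ m) * Zh m X (skip j Y) (l + 1)"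
      by (simp add: P'_def R'_def prod_dividef diff_add_eq)
    have VX: "vandermonde ?n X = vandermonde m X * P"
      unfolding vandermonde_Suc P_def using x by simp
    have VY: "vandermonde ?n Y = (- 1) ^ j * R * vandermonde m (skip j Y)"
      unfolding R_def by (rule vandermonde_skip[OF j])
    have D: "det_sum ?n X Y l g = (- 1) ^ (m + j) * (P * P') * (B 1 * B g * R * R') * det_sum m X (skip j Y) (l + 1) g"
      using det_sum_Suc_at_y[where X = X and Y = Y and l = l and g = g, OF j x] by (simp add: P_def P'_def R_def R'_def prod.distrib)
    have S': "(\<Sum>i<?n. X i) - (\<Sum>j<?n. Y j) + l + g + of_nat ?n
      = (\<Sum>i<m. X i) - (\<Sum>k<m. skip j Y k) + (l + 1) + g + of_nat m"
      unfolding S[OF j] x by simp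
    have "scaled_Z ?n X Y l g = scaled_Z m X (skip j Y) (l + 1) g * (B 1 * B g * P' * ((- 1) ^ j * R) * P * R')"
      unfolding scaled_Z_def S' Z VX VY B1 using B_1 by (simp add: field_simps)
    also have "\<dots> = scaled_dets ?n X Y l g"
      unfolding IH scaled_dets_def D choose_two_Suc sgn[of j, symmetric] by (simp add: mult_ac add_ac)
    finally show ?thesis .
  qed
  define F where "F z = scaled_Z ?n (X(m := z)) Y l g - scaled_dets ?n (X(m := z)) Y l g" for z
  define ps where "ps = map Y [0..<?n] @ map (\<lambda>k. Y k - 1) [0..<?n]"
  have "F (X m) = 0"
  proof (rule theta_fun_eq_0[of ps "2 * (\<Sum>k<?n. Y k) - g - of_nat ?n" F])
    have "length ps = 2 * ?n" by (simp add: ps_def)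
    then show "theta_fun (length ps) (2 * (\<Sum>k<?n. Y k) - g - of_nat ?n) F"
      unfolding F_def scaled_dets_def by (simp only:) (intro theta_fun_diff theta_fun_scaled_Z theta_fun_cmult theta_fun_det_sum)
    show "F a = 0" if "a \<in> set ps" for a
    proof -
      from that have "a \<in> Y ` {..<?n} \<union> (\<lambda>k. Y k - 1) ` {..<?n}"
        by (auto simp: ps_def simp del: upt_Suc)
      then obtain k where "k < ?n" "a = Y k \<or> a = Y k - 1" by blast
      then show ?thesis unfolding F_def using at_y[of k "X(m := a)"] at_y_minus_1[of k "X(m := a)"] by auto
    qed
    show "sorted_wrt (\<lambda>a b. B (b - a) \<noteq> 0) ps"
    proof -
      have d: "B (Y b - Y a) \<noteq> 0" if "a < b" "b < ?n" for a b
        using Y[of b a] that by simp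
      \<comment> \<open>Nodes of different families: for a = b the difference is -1, and [1] is
        nonzero.\<close>
      have e: "B (Y b - 1 - Y a) \<noteq> 0" if "a < ?n" "b < ?n" for a b
      proof -
        have "B (Y a - Y b + 1) \<noteq> 0" using Y[of a b] B_1 that by (cases "a = b") auto
        then show ?thesis using B_minus[of "Y a - Y b + 1"] by (simp add: algebra_simps)
      qed
      show ?thesis unfolding ps_def sorted_wrt_append
        using d e by (auto simp: sorted_wrt_map sorted_wrt_iff_nth_less simp del: upt_Suc)
    qed
    have "sum_list ps = 2 * (\<Sum>k<?n. Y k) - of_nat ?n"
      unfolding ps_def by (simp add: interv_sum_list_conv_sum_set_nat sum_subtractf lessThan_atLeast0 del: upt_Suc sum.op_ivl_Suc)
    then have e: "2 * (\<Sum>k<?n. Y k) - g - of_nat ?n - sum_list ps = - g" by simp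
    show "B (2 * (\<Sum>k<?n. Y k) - g - of_nat ?n - sum_list ps) \<noteq> 0"
      unfolding e using g B_minus[of g] by simp
  qed
  then show ?case by (simp add: F_def)
qed

section \<open>Non-generic parameters and the identity\<close>

lemma isCont_W:
  fixes z :: complex
  assumes "isCont L z" "isCont U z" "B (L z + of_int a) \<noteq> 0"
  shows "isCont (\<lambda>t. W (L t) a b c d (U t)) z"
proof -
  have if_cont: "isCont (\<lambda>t. if P then f t else g t) z" if "isCont f z" "isCont g z" for P and f g :: "complex \<Rightarrow> complex"
    using that by (cases P) auto
  show ?thesis
    unfolding W_def Rmat_def by (intro if_cont continuous_intros assms) (use assms(3) B_1 in auto)
qed

text \<open>Poles in \<lambda> can arise only from [\<lambda> + a] with a height a between 0 and n;
  hence the range of k in the hypothesis.\<close>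

lemma isCont_Zh:
  fixes z :: complex
  assumes "isCont L z" "\<And>j. isCont (\<lambda>t. Y t j) z" and nz: "\<And>k. k \<le> n \<Longrightarrow> B (L z + of_nat k) \<noteq> 0"
  shows "isCont (\<lambda>t. Zh n X (Y t) (L t)) z"
  unfolding Zh_def
proof (intro continuous_intros isCont_W assms(1,2))
  fix A i j assume A: "A \<in> height_functions n" and "i \<in> {..<n}" "j \<in> {..<n}"
  then have "A i j \<ge> 0" "A i j \<le> int n" using height_bounds[OF A, of i j] by auto
  then have "nat (A i j) \<le> n" and e: "of_int (A i j) = (of_nat (nat (A i j)) :: complex)" by auto
  then show "B (L z + of_int (A i j)) \<noteq> 0" unfolding e by (intro nz)
qed

end

lemma isCont_det:
  fixes f :: "nat \<Rightarrow> nat \<Rightarrow> complex \<Rightarrow> complex"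
  assumes "\<And>i j. i < n \<Longrightarrow> j < n \<Longrightarrow> isCont (f i j) z"
  shows "isCont (\<lambda>t. Determinant.det (Matrix.mat n n (\<lambda>(i, j). f i j t))) z"
proof -
  let ?A = "\<lambda>t. Matrix.mat n n (\<lambda>(i, j). f i j t)"
  have "isCont (\<lambda>t. ?A t $$ (i, p i)) z" if "p permutes {0..<n}" "i \<in> {0..<n}" for p i
  proof -
    have "p i \<in> {0..<n}" using that permutes_in_image by metis
    then have "p i < n" "i < n" using that by simp_all
    then show ?thesis using assms[of i "p i"] by simp
  qed
  then have "isCont (\<lambda>t. \<Sum>p\<in>{p. p permutes {0..<n}}. signof p * (\<Prod>i = 0..<n. ?A t $$ (i, p i))) z"
    by (intro continuous_intros) simp
  moreover have "Determinant.det (?A t) = (\<Sum>p\<in>{p. p permutes {0..<n}}. signof p * (\<Prod>i = 0..<n. ?A t $$ (i, p i)))" for t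
    by (rule det_def') simp
  ultimately show ?thesis by simp
qed

context theta
begin

lemma isCont_det_sum:
  fixes z :: complex
  assumes "isCont L z" "\<And>j. isCont (\<lambda>t. Y t j) z" and nz: "\<And>k. k \<le> n \<Longrightarrow> B (L z + of_nat k) \<noteq> 0"
  shows "isCont (\<lambda>t. det_sum n X (Y t) (L t) g) z"
  unfolding det_sum_def dets_def entry_def
proof (intro continuous_intros isCont_det assms(1,2))
  fix S assume "S \<in> Pow {..<n}"
  then have "card S \<le> n" using card_mono[of "{..<n}" S] by auto
  then have e: "L z + of_nat n - of_nat (card S) = L z + of_nat (n - card S)" by (simp add: of_nat_diff)
  show "B (L z + of_nat n - of_nat (card S)) \<noteq> 0" unfolding e by (rule nz) simp
qed

text \<open>\<lambda> and y are deformed along a complex line through the given point. The generic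
  identity holds on it off a countable set, and both sides are continuous at t = 0.\<close>

lemma scaled_Z_eq_scaled_dets:
  assumes nz: "\<And>k. k \<le> n \<Longrightarrow> B (l + of_nat k) \<noteq> 0" and g: "B g \<noteq> 0"
  shows "scaled_Z n X Y l g = scaled_dets n X Y l g"
proof -
  \<comment> \<open>The slopes j are pairwise different, so no difference of two entries is constant
    in t.\<close>
  define Yt where "Yt t j = Y j + of_nat j * t" for t j
  define C where "C = (\<Union>k. {t. B (l + of_int k + t) = 0}) \<union>
    (\<Union>(a, b)\<in>{(a, b). a \<noteq> b}. {t. B (Y a - Y b + of_int (int a - int b) * t) = 0} \<union>
      {t. B (Y a - Y b + 1 + of_int (int a - int b) * t) = 0})"
  have "countable {t. B (l + of_int k + t) = 0}" for k
    using countable_B_zeros[of 1 "l + of_int k"] by simp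
  then have "countable C"
    unfolding C_def
    by (intro countable_Un countable_UN)
      (auto simp del: of_int_diff of_int_of_nat_eq intro!: countable_Un countable_B_zeros)
  have "scaled_Z n X (Yt 0) (l + 0) g - scaled_dets n X (Yt 0) (l + 0) g = 0"
  proof (rule isCont_eq_off_countable[where f = "\<lambda>t. scaled_Z n X (Yt t) (l + t) g - scaled_dets n X (Yt t) (l + t) g", OF _ \<open>countable C\<close>])
    have Y: "isCont (\<lambda>t. Yt t j) 0" for j unfolding Yt_def by (intro continuous_intros)
    show "isCont (\<lambda>t. scaled_Z n X (Yt t) (l + t) g - scaled_dets n X (Yt t) (l + t) g) 0"
      unfolding scaled_Z_def scaled_dets_def vandermonde_def
      by (intro continuous_intros isCont_Zh isCont_det_sum Y) (use nz in auto)
    fix t assume t: "t \<notin> C"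
    have "scaled_Z n X (Yt t) (l + t) g = scaled_dets n X (Yt t) (l + t) g"
    proof (rule scaled_Z_eq_scaled_dets_generic[OF _ _ g])
      show "B (l + t + of_int k) \<noteq> 0" for k
        using t by (simp add: C_def add_ac)
      show "B (Yt t a - Yt t b) \<noteq> 0 \<and> B (Yt t a - Yt t b + 1) \<noteq> 0" if "a \<noteq> b" for a b
        using t that by (force simp: C_def Yt_def algebra_simps)
    qed
    then show "scaled_Z n X (Yt t) (l + t) g - scaled_dets n X (Yt t) (l + t) g = 0" by simp
  qed
  moreover have "Yt 0 = Y" by (auto simp: Yt_def)
  ultimately show ?thesis by simp
qed

section \<open>Return to quotients and to indices starting at 1\<close>

text \<open>Row i is cleared by the same factor for every S, because it contains both [x_i - y_k]
  and [x_i + 1 - y_k]; the product of these factors can therefore leave the sum over S.\<close>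

lemma dets_eq:
  assumes "\<And>i j. i < n \<Longrightarrow> j < n \<Longrightarrow> B (X i - Y j) \<noteq> 0 \<and> B (X i + 1 - Y j) \<noteq> 0"
  shows "dets n X Y g S = (\<Prod>i<n. \<Prod>j<n. B (X i - Y j) * B (X i + 1 - Y j))
    * Determinant.det (Matrix.mat n n (\<lambda>(i, j). B (shifted X S i - Y j + g) / B (shifted X S i - Y j)))"
proof -
  have "entry n Y g (shifted X S i) (shifted X (- S) i) j
      = (\<Prod>j<n. B (X i - Y j) * B (X i + 1 - Y j)) * (B (shifted X S i - Y j + g) / B (shifted X S i - Y j))"
    if "i < n" "j < n" for i j
  proof -
    have "(\<Prod>k<n. B (X i - Y k) * B (X i + 1 - Y k)) = (\<Prod>k<n. B (shifted X S i - Y k)) * (\<Prod>k<n. B (shifted X (- S) i - Y k))"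
      unfolding prod.distrib[symmetric] by (rule prod.cong) (auto simp: shifted_def)
    moreover have "(\<Prod>k<n. B (shifted X S i - Y k)) = B (shifted X S i - Y j) * (\<Prod>k\<in>{..<n} - {j}. B (shifted X S i - Y k))"
      using that by (intro prod.remove) auto
    moreover have "B (shifted X S i - Y j) \<noteq> 0" using assms that by (simp add: shifted_def)
    ultimately show ?thesis by (simp add: entry_def)
  qed
  then have "Matrix.mat n n (\<lambda>(i, j). entry n Y g (shifted X S i) (shifted X (- S) i) j)
    = Matrix.mat n n (\<lambda>(i, j). (\<Prod>j<n. B (X i - Y j) * B (X i + 1 - Y j)) * (B (shifted X S i - Y j + g) / B (shifted X S i - Y j)))"
    by (intro eq_matI) auto
  then show ?thesis unfolding dets_def by (simp only: det_scale_rows)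
qed

lemma prod_pairs_eq_vandermonde:
  "(\<Prod>(i, j)\<in>{(i, j). 1 \<le> i \<and> i < j \<and> j \<le> n}. B (x i - x j) * B (y i - y j))
    = vandermonde n (\<lambda>i. x (Suc i)) * vandermonde n (\<lambda>i. y (Suc i))"
proof -
  have "vandermonde n (\<lambda>i. x (Suc i)) * vandermonde n (\<lambda>i. y (Suc i))
    = (\<Prod>(j, i)\<in>(SIGMA j:{..<n}. {..<j}). B (x (Suc i) - x (Suc j)) * B (y (Suc i) - y (Suc j)))"
    unfolding vandermonde_def prod.distrib[symmetric] by (subst prod.Sigma) auto
  also have "\<dots> = (\<Prod>(i, j)\<in>{(i, j). 1 \<le> i \<and> i < j \<and> j \<le> n}. B (x i - x j) * B (y i - y j))"
    by (rule prod.reindex_bij_witness[where i = "\<lambda>(i, j). (j - 1, i - 1)" and j = "\<lambda>(j, i). (Suc i, Suc j)"]) auto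
  finally show ?thesis ..
qed

text \<open>With \<open>f\<close> and \<open>h\<close> arbitrary, the reindexing only has to respect
  the cardinality and the shifted sequence.\<close>

lemma sum_dets_shift:
  "(\<Sum>S\<in>Pow {..<n}. f (card S) * h (shifted (\<lambda>i. x (Suc i)) S)) = (\<Sum>S\<in>Pow {1..n}. f (card S) * h (\<lambda>i. xshift x S (Suc i)))"
  for f :: "nat \<Rightarrow> complex"
proof (rule sum.reindex_bij_witness[where i = "\<lambda>S. (\<lambda>i. i - 1) ` S" and j = "\<lambda>S. Suc ` S"])
  fix S assume S: "S \<in> Pow {..<n}"
  show "(\<lambda>i. i - 1) ` Suc ` S = S" by (simp add: image_image)
  show "Suc ` S \<in> Pow {1..n}" using S by auto
  show "f (card (Suc ` S)) * h (\<lambda>i. xshift x (Suc ` S) (Suc i)) = f (card S) * h (shifted (\<lambda>i. x (Suc i)) S)"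
    by (simp add: card_image xshift_def shifted_def[abs_def] inj_image_mem_iff)
next
  fix S assume S: "S \<in> Pow {1..n}"
  then have "(\<lambda>i. Suc (i - 1)) ` S = (\<lambda>i. i) ` S" by (intro image_cong) auto
  then show "Suc ` (\<lambda>i. i - 1) ` S = S" by (simp add: image_image)
  show "(\<lambda>i. i - 1) ` S \<in> Pow {..<n}"
    using S by fastforce
qed

lemma partition_function:
  fixes lam \<gamma> :: complex and n :: nat and x y :: "nat \<Rightarrow> complex"
  assumes "\<And>k. k \<le> n \<Longrightarrow> B (lam + of_nat k) \<noteq> 0"
    and "\<And>i j. 1 \<le> i \<Longrightarrow> i < j \<Longrightarrow> j \<le> n \<Longrightarrow> B (x i - x j) \<noteq> 0"
    and "\<And>i j. 1 \<le> i \<Longrightarrow> i < j \<Longrightarrow> j \<le> n \<Longrightarrow> B (y i - y j) \<noteq> 0"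
    and "\<And>i j. i \<in> {1..n} \<Longrightarrow> j \<in> {1..n} \<Longrightarrow> B (x i - y j) \<noteq> 0"
    and "\<And>i j. i \<in> {1..n} \<Longrightarrow> j \<in> {1..n} \<Longrightarrow> B (x i + 1 - y j) \<noteq> 0"
    and "B \<gamma> \<noteq> 0"
    and "B ((\<Sum>i=1..n. x i) - (\<Sum>j=1..n. y j) + lam + \<gamma> + of_nat n) \<noteq> 0"
  shows "Z \<tau> \<eta> n x y lam =
    (-1) ^ (n choose 2) * B (lam + of_nat n)
      / (B 1 ^ (n ^ 2) * B \<gamma> ^ n * B ((\<Sum>i=1..n. x i) - (\<Sum>j=1..n. y j) + lam + \<gamma> + of_nat n))
    * ((\<Prod>i=1..n. \<Prod>j=1..n. B (x i - y j) * B (x i + 1 - y j))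
      / (\<Prod>(i, j)\<in>{(i, j). 1 \<le> i \<and> i < j \<and> j \<le> n}. B (x i - x j) * B (y i - y j)))
    * (\<Sum>S\<in>Pow {1..n}. (-1) ^ card S
        * (B (lam + \<gamma> + of_nat n - of_nat (card S)) / B (lam + of_nat n - of_nat (card S)))
        * Determinant.det (Matrix.mat n n (\<lambda>(i, j).
            B (xshift x S (i + 1) - y (j + 1) + \<gamma>) / B (xshift x S (i + 1) - y (j + 1)))))"
proof -
  define X where "X i = x (Suc i)" for i
  define Y where "Y i = y (Suc i)" for i
  define P where "P = (\<Prod>i<n. \<Prod>j<n. B (X i - Y j) * B (X i + 1 - Y j))"
  define w where "w = B ((\<Sum>i<n. X i) - (\<Sum>j<n. Y j) + lam + \<gamma> + of_nat n)"
  define \<Sigma> where "\<Sigma> = (\<Sum>S\<in>Pow {1..n}. ((-1) ^ card S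
        * (B (lam + \<gamma> + of_nat n - of_nat (card S)) / B (lam + of_nat n - of_nat (card S))))
        * Determinant.det (Matrix.mat n n (\<lambda>(i, j).
            B (xshift x S (i + 1) - y (j + 1) + \<gamma>) / B (xshift x S (i + 1) - y (j + 1)))))"
  have XY: "X = (\<lambda>i. x (Suc i))" "Y = (\<lambda>i. y (Suc i))" by (auto simp: X_def Y_def)
  have S: "(\<Sum>i=1..n. x i) = (\<Sum>i<n. X i)" "(\<Sum>i=1..n. y i) = (\<Sum>i<n. Y i)"
    by (simp_all add: X_def Y_def sum.atLeast1_atMost_eq)
  have P: "(\<Prod>i=1..n. \<Prod>j=1..n. B (x i - y j) * B (x i + 1 - y j)) = P"
    by (simp add: P_def X_def Y_def prod.atLeast1_atMost_eq)
  have VX: "vandermonde n X \<noteq> 0" and VY: "vandermonde n Y \<noteq> 0"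
    using assms(2,3) by (auto simp: vandermonde_def X_def Y_def)
  have w: "w \<noteq> 0" using assms(7) unfolding S w_def .
  have "dets n X Y \<gamma> S = P * Determinant.det (Matrix.mat n n (\<lambda>(i, j). B (shifted X S i - Y j + \<gamma>) / B (shifted X S i - Y j)))" for S
    unfolding P_def using assms(4,5) by (intro dets_eq) (auto simp: X_def Y_def)
  then have "det_sum n X Y lam \<gamma> = P * (\<Sum>S\<in>Pow {..<n}. ((-1) ^ card S
        * (B (lam + \<gamma> + of_nat n - of_nat (card S)) / B (lam + of_nat n - of_nat (card S))))
        * Determinant.det (Matrix.mat n n (\<lambda>(i, j). B (shifted X S i - Y j + \<gamma>) / B (shifted X S i - Y j))))"
    by (simp add: det_sum_def sum_distrib_left mult_ac)
  also have "\<dots> = P * \<Sigma>"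
    unfolding \<Sigma>_def XY by (subst sum_dets_shift) simp
  finally have D: "det_sum n X Y lam \<gamma> = P * \<Sigma>" .
  have "scaled_Z n X Y lam \<gamma> = scaled_dets n X Y lam \<gamma>"
    by (rule scaled_Z_eq_scaled_dets) (use assms in auto)
  then have "B 1 ^ (n\<^sup>2) * B \<gamma> ^ n * w * vandermonde n X * vandermonde n Y * Zh n X Y lam
      = (- 1) ^ (n choose 2) * B (lam + of_nat n) * (P * \<Sigma>)"
    by (simp add: scaled_Z_def scaled_dets_def D w_def)
  then have "Zh n X Y lam = (- 1) ^ (n choose 2) * B (lam + of_nat n) / (B 1 ^ (n\<^sup>2) * B \<gamma> ^ n * w) * (P / (vandermonde n X * vandermonde n Y)) * \<Sigma>"
    using VX VY w B_1 assms(6) by (simp add: field_simps)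
  then show ?thesis
    unfolding Z_eq_Zh P S prod_pairs_eq_vandermonde XY[symmetric] w_def[symmetric] \<Sigma>_def[symmetric] .
qed

end

theorem theorem5p1:
  fixes \<tau> \<eta> lam \<gamma> :: complex and n :: nat and x y :: "nat \<Rightarrow> complex"
  assumes "Im \<tau> > 0"
    and "\<eta> \<notin> {of_int k + \<tau> * of_int l | k l. True}"
    and "\<And>k. k \<le> n \<Longrightarrow> br \<tau> \<eta> (lam + of_nat k) \<noteq> 0"
    and "\<And>i j. 1 \<le> i \<Longrightarrow> i < j \<Longrightarrow> j \<le> n \<Longrightarrow> br \<tau> \<eta> (x i - x j) \<noteq> 0"
    and "\<And>i j. 1 \<le> i \<Longrightarrow> i < j \<Longrightarrow> j \<le> n \<Longrightarrow> br \<tau> \<eta> (y i - y j) \<noteq> 0"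
    and "\<And>i j. i \<in> {1..n} \<Longrightarrow> j \<in> {1..n} \<Longrightarrow> br \<tau> \<eta> (x i - y j) \<noteq> 0"
    and "\<And>i j. i \<in> {1..n} \<Longrightarrow> j \<in> {1..n} \<Longrightarrow> br \<tau> \<eta> (x i + 1 - y j) \<noteq> 0"
    and "br \<tau> \<eta> \<gamma> \<noteq> 0"
    and "br \<tau> \<eta> ((\<Sum>i=1..n. x i) - (\<Sum>j=1..n. y j) + lam + \<gamma> + of_nat n) \<noteq> 0"
  shows "Z \<tau> \<eta> n x y lam =
    (-1) ^ (n choose 2) * br \<tau> \<eta> (lam + of_nat n)
      / (br \<tau> \<eta> 1 ^ (n ^ 2) * br \<tau> \<eta> \<gamma> ^ n
          * br \<tau> \<eta> ((\<Sum>i=1..n. x i) - (\<Sum>j=1..n. y j) + lam + \<gamma> + of_nat n))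
    * ((\<Prod>i=1..n. \<Prod>j=1..n. br \<tau> \<eta> (x i - y j) * br \<tau> \<eta> (x i + 1 - y j))
      / (\<Prod>(i, j)\<in>{(i, j). 1 \<le> i \<and> i < j \<and> j \<le> n}. br \<tau> \<eta> (x i - x j) * br \<tau> \<eta> (y i - y j)))
    * (\<Sum>S\<in>Pow {1..n}. (-1) ^ card S
        * (br \<tau> \<eta> (lam + \<gamma> + of_nat n - of_nat (card S)) / br \<tau> \<eta> (lam + of_nat n - of_nat (card S)))
        * Determinant.det (Matrix.mat n n (\<lambda>(i, j).
            br \<tau> \<eta> (xshift x S (i + 1) - y (j + 1) + \<gamma>) / br \<tau> \<eta> (xshift x S (i + 1) - y (j + 1)))))"
proof -
  interpret theta \<tau> \<eta> by (rule theta.intro[OF assms(1,2)])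
  show ?thesis using assms(3-) by (rule partition_function)
qed

end
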